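(* (a) Consider the non-backtracking exploration. Let $G_n$ converge locally in probability to $(G_\infty,\phi)$ as $n\to\infty$, and let the minimum degree in $G_n$ be at least $3$ for all sufficiently large $n$. Let $(G_\infty,\phi)$ have a deterministic law $\bar\Lambda$ and satisfy: (I) $d_\phi$ is independent of $(d_i)_{i\in\mathbb N}$; (II) $(d_i)_{i\in\mathbb N}$ are i.i.d. with a finite second moment. Then, as $k\to\infty$, $$\Delta_\phi^{(k)}\to\Delta_\phi=\frac{m^{(2)}}{m^{(1)}}-d_\phi\quad\text{in probability},$$ where $m^{(1)}=\mathbb E_{\bar\Lambda}[d_\phi]$ and $m^{(2)}=\mathbb E_{\bar\Lambda}[d_\phi^2]$. In particular, $\mu_\infty^{(k)}$ converges weakly to $\mu$ as $k\to\infty$, where $\mu$ is the law of $\Delta_\phi$. (b) Consider the backtracking exploration. Let $(G_\infty,\phi)$ be almost surely finite and non-bipartite, with law $\bar\Lambda$. Then, as $k\to\infty$, $$\Delta_\phi^{(k)}\to\Delta_\phi^\star=\frac{\sum_{j\in V(G_\infty)}(d_j^{(G_\infty)})^2}{\sum_{j\in V(G_\infty)}d_j^{(G_\infty)}}-d_\phi\quad\text{almost surely}.$$ In particular, if $\bar\Lambda$ is deterministic, then $\mu_\infty^{(k)}$ converges weakly to $\mu^\star$ as $k\to\infty$, where $\mu^\star$ is the law of $\Delta_\phi^\star$.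
   Context: $d_i^{(G)}$ is the degree of vertex $i$ in the graph $G$. $(G_\infty,\phi)$ is an almost surely locally finite rooted random tree with root $\phi$ and law $\bar\Lambda$; $\mathbb E_{\bar\Lambda}$ is the corresponding expectation. "Deterministic law" means that $\bar\Lambda$ is a fixed (non-random) probability measure. The vertices in $V(G_\infty)\setminus\{\phi\}$ are labelled by natural numbers. $d_j$ is the number of offspring of $j\in V(G_\infty)$, so $d_\phi=d_\phi^{(G_\infty)}$ and $d_j^{(G_\infty)}=d_j+1$ for $j\ne\phi$. - Non-backtracking exploration: $G_n$ is a simple random graph on $[n]=\{1,\dots,n\}$, $n\ge3$, with minimum degree at least $2$. The tree $(G_\infty,\phi)$ is infinite and every vertex has at least one offspring; the walk on the tree starts at $\phi$ and at each step moves to a uniformly chosen offspring of its current position. - Backtracking exploration: the tree is non-trivial (more than one vertex); the walk starts at $\phi$ and at each step moves to a uniformly chosen neighbour of its current position. $P^k(\phi,j)$ is the probability, given the tree, that the walk is at $j$ after $k$ steps. The $k$-level friendship bias of the root is $\Delta_\phi^{(k)}=\sum_{j\in V(G_\infty)}P^k(\phi,j)\,d_j^{(G_\infty)}-d_\phi$, and $\mu_\infty^{(k)}$ is its law. Local convergence in probability. For a rooted graph $(H,o)$, $B_r^{(H)}(o)$ is the rooted subgraph with root $o$ whose vertices are those at graph distance $\le r$ from $o$ and whose edges are all edges of $H$ between such vertices. $\mathscr G$ is the set of connected locally finite rooted graphs, up to rooted isomorphism, with metric $\mathrm d_{\mathscr G}((H_1,o_1),(H_2,o_2))=\big(1+\sup\{r\ge0: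 B_r^{(H_1)}(o_1)\simeq B_r^{(H_2)}(o_2)\}\big)^{-1}$. $\mathscr C(G_n,i)$ is the connected component of $i$ in $G_n$, rooted at $i$. $G_n$ converges locally in probability to $(G_\infty,\phi)$ if $\frac1n\sum_{i\in[n]}h(\mathscr C(G_n,i))\to\mathbb E_{\bar\Lambda}[h((G_\infty,\phi))]$ in probability for every bounded continuous $h:\mathscr G\to\mathbb R$.
   Formalization: In (a) the non-root vertices are labelled 1,2,… breadth-first, families in the order of their parents (for arbitrary labellings the claim fails, e.g. a (3,4)-biregular tree); (b) is stated for connected locally finite rooted graphs, since a tree is never non-bipartite. *)

theory Defs
  imports "HOL-Probability.Probability"
begin

(* Vertices are natural numbers: every connected locally finite graph is countable. *)

record ugraph =
  verts :: "nat set"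
  edges :: "nat set set"

record rgraph = ugraph +
  vroot :: nat

definition simple_graph :: "'z ugraph_scheme \<Rightarrow> bool" where
  "simple_graph H \<longleftrightarrow> edges H \<subseteq> {{u, v} | u v. u \<in> verts H \<and> v \<in> verts H \<and> u \<noteq> v}"

definition nbrs :: "'z ugraph_scheme \<Rightarrow> nat \<Rightarrow> nat set" where
  "nbrs H v = {w. {v, w} \<in> edges H}"

definition deg :: "'z ugraph_scheme \<Rightarrow> nat \<Rightarrow> nat" where
  "deg H v = card (nbrs H v)"

definition adj_rel :: "'z ugraph_scheme \<Rightarrow> (nat \<times> nat) set" where
  "adj_rel H = {(v, w). {v, w} \<in> edges H}"

definition gdist :: "'z ugraph_scheme \<Rightarrow> nat \<Rightarrow> nat \<Rightarrow> enat" where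
  "gdist H v w = (INF k\<in>{k. (v, w) \<in> adj_rel H ^^ k}. enat k)"

definition connected_graph :: "'z ugraph_scheme \<Rightarrow> bool" where
  "connected_graph H \<longleftrightarrow> (\<forall>v\<in>verts H. \<forall>w\<in>verts H. (v, w) \<in> (adj_rel H)\<^sup>*)"

definition locally_finite :: "'z ugraph_scheme \<Rightarrow> bool" where
  "locally_finite H \<longleftrightarrow> (\<forall>v\<in>verts H. finite (nbrs H v))"

definition cycle_free :: "'z ugraph_scheme \<Rightarrow> bool" where
  "cycle_free H \<longleftrightarrow> \<not> (\<exists>c. 3 \<le> length c \<and> distinct c \<and>
     (\<forall>i<length c. {c ! i, c ! (Suc i mod length c)} \<in> edges H))"

definition is_tree :: "'z ugraph_scheme \<Rightarrow> bool" where
  "is_tree H \<longleftrightarrow> simple_graph H \<and> connected_graph H \<and> cycle_free H"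

definition bipartite :: "'z ugraph_scheme \<Rightarrow> bool" where
  "bipartite H \<longleftrightarrow> (\<exists>A B. A \<union> B = verts H \<and> A \<inter> B = {} \<and>
     (\<forall>e\<in>edges H. \<exists>a\<in>A. \<exists>b\<in>B. e = {a, b}))"


subsection \<open>The space of rooted graphs and local convergence\<close>

definition rgraphs :: "rgraph set" where
  "rgraphs = {H. simple_graph H \<and> vroot H \<in> verts H \<and> connected_graph H \<and> locally_finite H}"

definition rgraph_iso :: "rgraph \<Rightarrow> rgraph \<Rightarrow> bool" where
  "rgraph_iso H K \<longleftrightarrow> (\<exists>f. bij_betw f (verts H) (verts K) \<and> f (vroot H) = vroot K \<and>
     (\<forall>v\<in>verts H. \<forall>w\<in>verts H. {v, w} \<in> edges H \<longleftrightarrow> {f v, f w} \<in> edges K))"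

definition induced_rooted :: "'z ugraph_scheme \<Rightarrow> nat set \<Rightarrow> nat \<Rightarrow> rgraph" where
  "induced_rooted H A r = \<lparr>verts = A, edges = {e \<in> edges H. e \<subseteq> A}, vroot = r\<rparr>"

definition rball :: "nat \<Rightarrow> rgraph \<Rightarrow> rgraph" where
  "rball r H = induced_rooted H {v \<in> verts H. gdist H (vroot H) v \<le> enat r} (vroot H)"

definition component_at :: "ugraph \<Rightarrow> nat \<Rightarrow> rgraph" where
  "component_at H i = induced_rooted H {v \<in> verts H. (i, v) \<in> (adj_rel H)\<^sup>*} i"

(* The supremum is infinite, and the distance 0, when all balls are isomorphic. *)
definition local_dist :: "rgraph \<Rightarrow> rgraph \<Rightarrow> real" where
  "local_dist H K =
     real_of_ereal (inverse (1 + (SUP r\<in>{r. rgraph_iso (rball r H) (rball r K)}. ereal (real r))))"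

(* Rooted graphs are taken up to isomorphism by working on representatives: local_dist is a
   pseudometric on rgraphs that vanishes on isomorphic graphs, so the functions below take the
   same value on isomorphic graphs and are the bounded continuous functions on the quotient. *)
definition local_bdd_cont :: "(rgraph \<Rightarrow> real) \<Rightarrow> bool" where
  "local_bdd_cont h \<longleftrightarrow> bounded (h ` rgraphs) \<and>
     (\<forall>H\<in>rgraphs. \<forall>\<epsilon>>0. \<exists>\<delta>>0. \<forall>K\<in>rgraphs. local_dist H K < \<delta> \<longrightarrow> \<bar>h K - h H\<bar> < \<epsilon>)"

(* A law on this space is the law of a labelled representative; every bounded continuous
   function above is measurable. *)
definition rgraph_space :: "rgraph measure" where
  "rgraph_space = sigma rgraphs
     ((\<lambda>v. {H \<in> rgraphs. v \<in> verts H}) ` UNIV \<union>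
      (\<lambda>(v, w). {H \<in> rgraphs. {v, w} \<in> edges H}) ` UNIV \<union>
      (\<lambda>v. {H \<in> rgraphs. vroot H = v}) ` UNIV)"

definition conv_in_prob :: "'w measure \<Rightarrow> (nat \<Rightarrow> 'w \<Rightarrow> real) \<Rightarrow> ('w \<Rightarrow> real) \<Rightarrow> bool" where
  "conv_in_prob M X Y \<longleftrightarrow>
     (\<forall>\<epsilon>>0. (\<lambda>n. measure M {x \<in> space M. \<epsilon> < \<bar>X n x - Y x\<bar>}) \<longlonglongrightarrow> 0)"

(* The law of the limit may itself be random; a deterministic law L is the case \<Lambda> = (\<lambda>_. L). *)
definition local_conv_in_prob ::
    "'w measure \<Rightarrow> (nat \<Rightarrow> 'w \<Rightarrow> ugraph) \<Rightarrow> ('w \<Rightarrow> rgraph measure) \<Rightarrow> bool" where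
  "local_conv_in_prob P G \<Lambda> \<longleftrightarrow>
     (\<forall>h. local_bdd_cont h \<longrightarrow>
        conv_in_prob P (\<lambda>n x. (\<Sum>i\<in>{1..n}. h (component_at (G n x) i)) / real n)
          (\<lambda>x. \<integral>T. h T \<partial>\<Lambda> x))"


subsection \<open>Exploration and friendship bias\<close>

definition offspring :: "rgraph \<Rightarrow> nat \<Rightarrow> nat set" where
  "offspring T v = {w \<in> nbrs T v. gdist T (vroot T) w = gdist T (vroot T) v + 1}"

definition noff :: "rgraph \<Rightarrow> nat \<Rightarrow> nat" where
  "noff T v = card (offspring T v)"

(* Labelling of the vertices of an infinite tree by the natural numbers, with label 0 for the
   root and labels 1, 2, ... for the other vertices. The labels run through the tree generation
   by generation, families being listed in the order of the parents; the order among siblings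
   is arbitrary. Some such convention is needed: if the labels may depend on the offspring
   numbers, independence of the labelled offspring numbers says little about the tree. *)
definition bfs_labelled :: "rgraph \<Rightarrow> bool" where
  "bfs_labelled T \<longleftrightarrow> verts T = UNIV \<and> vroot T = 0 \<and>
     (\<forall>v. \<forall>w\<in>offspring T v. v < w) \<and>
     (\<forall>u v. u < v \<longrightarrow> (\<forall>x\<in>offspring T u. \<forall>y\<in>offspring T v. x < y))"

(* Law of the position after k steps of the walk from the root that moves to a uniform element
   of S v. The walk stays put if S v is empty, which does not occur in the graphs considered. *)
fun walk_law :: "(nat \<Rightarrow> nat set) \<Rightarrow> nat \<Rightarrow> nat \<Rightarrow> nat pmf" where
  "walk_law S r 0 = return_pmf r"
| "walk_law S r (Suc k) =
     bind_pmf (walk_law S r k)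
       (\<lambda>v. if finite (S v) \<and> S v \<noteq> {} then pmf_of_set (S v) else return_pmf v)"

definition bias :: "(rgraph \<Rightarrow> nat \<Rightarrow> nat set) \<Rightarrow> nat \<Rightarrow> rgraph \<Rightarrow> real" where
  "bias S k T =
     (\<Sum>\<^sub>\<infinity>j\<in>verts T. pmf (walk_law (S T) (vroot T) k) j * real (deg T j)) - real (deg T (vroot T))"

definition nonbacktracking_bias :: "nat \<Rightarrow> rgraph \<Rightarrow> real" where
  "nonbacktracking_bias = bias offspring"

(* Used for arbitrary connected graphs, not only trees: a tree is always bipartite. *)
definition backtracking_bias :: "nat \<Rightarrow> rgraph \<Rightarrow> real" where
  "backtracking_bias = bias nbrs"

definition stationary_bias :: "rgraph \<Rightarrow> real" where
  "stationary_bias T =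
     (\<Sum>j\<in>verts T. (real (deg T j))\<^sup>2) / (\<Sum>j\<in>verts T. real (deg T j)) - real (deg T (vroot T))"

end

theory Submission imports Defs begin

text \<open>Part (a). A breadth-first labelled tree is determined by its offspring numbers: the children of
  \<open>v\<close> occupy the block of labels between the partial sums of the offspring numbers up to \<open>v\<close>
  (\<open>regular_offspring\<close>). Hence the probability that the non-backtracking walk sits at \<open>j\<close> after \<open>k\<close>
  steps is a function \<open>explore_weight\<close> of the offspring numbers of labels below \<open>j\<close> only. The bias
  is therefore, up to a constant and the degree of the root, a sum of centred independent variables with
  predictable weights.
  Such a sum has orthogonal increments, so its second moment is the variance of one offspring number
  times the expected sum of squared weights (\<open>predictable_sum_second_moment\<close>). All vertices except
  possibly the root have at least two children, so no weight exceeds \<open>2 ^ - (k - 1)\<close>, and neither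
  does the sum of their squares. Chebyshev's inequality finishes the convergence.

  It remains to identify the mean of \<open>1 + noff T 1\<close> with \<open>m2 / m1\<close>, and this is where the local
  convergence enters. In a finite graph, the number of ordered adjacent pairs with degrees \<open>(a, b)\<close>
  is symmetric in \<open>a\<close> and \<open>b\<close>. The number of such pairs at the root is a bounded continuous
  function, so the symmetry survives in the limit (\<open>local_limit_mass_transport\<close>). With \<open>p\<close> the law of
  the degree of the root and \<open>q\<close> the law of \<open>1 + noff T 1\<close> it reads \<open>a p(a) q(b) = b p(b) q(a)\<close>, which
  says that \<open>q\<close> is the size-biased version of \<open>p\<close> (\<open>size_biased_mean\<close>); finiteness of the moments of
  \<open>p\<close> follows as well. The same count with \<open>b = 2\<close> vanishes when the minimum degree is three, which
  excludes vertices other than the root with a single child (\<open>local_limit_no_low_degree\<close>).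

  Part (b). For a fixed finite connected non-bipartite graph the claim is the ergodic theorem for the
  simple random walk. There is a length \<open>K\<close> such that any two vertices are joined by a walk of
  exactly \<open>K\<close> steps (\<open>uniform_walk_length\<close>). Averaging \<open>K\<close> times therefore shrinks the oscillation of a
  function on the vertices by a fixed factor, while its degree-weighted mean is conserved
  (\<open>walk_average_tendsto\<close>).

  In both parts convergence of the variables yields weak convergence of their laws.\<close>

section \<open>Distances in rooted graphs and trees\<close>

lemma edge_verts:
  assumes "simple_graph H" "{v, w} \<in> edges H"
  shows "v \<in> verts H" "w \<in> verts H" "v \<noteq> w"
proof -
  obtain a b where "{v, w} = {a, b}" "a \<in> verts H" "b \<in> verts H" "a \<noteq> b"
    using assms unfolding simple_graph_def by blast
  then show "v \<in> verts H" "w \<in> verts H" "v \<noteq> w"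
    by (auto simp: doubleton_eq_iff)
qed

lemma nbrs_subset_verts: "simple_graph H \<Longrightarrow> nbrs H v \<subseteq> verts H"
  using edge_verts(2) by (auto simp: nbrs_def)

lemma nbrs_commute: "w \<in> nbrs H v \<longleftrightarrow> v \<in> nbrs H w"
  by (simp add: nbrs_def insert_commute)

lemma nbrs_outside: "simple_graph H \<Longrightarrow> v \<notin> verts H \<Longrightarrow> nbrs H v = {}"
  using edge_verts(1) by (auto simp: nbrs_def)

text \<open>The distance is an infimum in \<open>enat\<close>; the next two lemmas express it by walks of given length,
  which is the form that induction and the measurability proofs need.\<close>

lemma gdist_eq_enat_iff:
  "gdist H v w = enat n \<longleftrightarrow> (v, w) \<in> adj_rel H ^^ n \<and> (\<forall>m<n. (v, w) \<notin> adj_rel H ^^ m)"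
proof -
  let ?K = "{k. (v, w) \<in> adj_rel H ^^ k}"
  show ?thesis
  proof (cases "?K = {}")
    case True
    then have "gdist H v w = \<infinity>" by (simp add: gdist_def top_enat_def)
    then show ?thesis using True by auto
  next
    case False
    define l where "l = (LEAST k. k \<in> ?K)"
    have l: "l \<in> ?K" and min: "\<And>k. k \<in> ?K \<Longrightarrow> l \<le> k"
      using False unfolding l_def by (auto intro: LeastI Least_le)
    have "gdist H v w = enat l"
      unfolding gdist_def by (rule antisym) (use l min in \<open>auto intro: INF_lower INF_greatest\<close>)
    then show ?thesis using l min
      by (auto simp: not_le[symmetric]) (meson linorder_neqE_nat not_le)
  qed
qed

lemma gdist_le_enat_iff: "gdist H v w \<le> enat n \<longleftrightarrow> (\<exists>m\<le>n. (v, w) \<in> adj_rel H ^^ m)"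
proof
  assume "gdist H v w \<le> enat n"
  then obtain m where "gdist H v w = enat m" "m \<le> n"
    by (metis enat_ile enat_ord_simps(1))
  then show "\<exists>m\<le>n. (v, w) \<in> adj_rel H ^^ m" by (auto simp: gdist_eq_enat_iff)
next
  assume "\<exists>m\<le>n. (v, w) \<in> adj_rel H ^^ m"
  then obtain m where m: "m \<le> n" "(v, w) \<in> adj_rel H ^^ m" by blast
  have "gdist H v w \<le> enat m" unfolding gdist_def by (rule INF_lower) (use m in auto)
  then show "gdist H v w \<le> enat n" using m by (meson enat_ord_simps(1) order_trans)
qed

lemma gdist_finite_if_reachable:
  assumes "(v, w) \<in> (adj_rel H)\<^sup>*"
  shows "\<exists>n. gdist H v w = enat n"
proof -
  obtain n where "(v, w) \<in> adj_rel H ^^ n" using assms by (auto simp: rtrancl_power)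
  then have "gdist H v w \<le> enat n" by (auto simp: gdist_le_enat_iff)
  then show ?thesis by (metis enat_ile)
qed

lemma gdist_self [simp]: "gdist H v v = 0"
  by (simp add: zero_enat_def gdist_eq_enat_iff)

lemma gdist_0_iff: "gdist H v w = 0 \<longleftrightarrow> v = w"
  by (auto simp: zero_enat_def gdist_eq_enat_iff)

lemma gdist_edge_le:
  assumes "{v, w} \<in> edges H" shows "gdist H r w \<le> gdist H r v + 1"
proof (cases "gdist H r v")
  case (enat n)
  then have "(r, w) \<in> adj_rel H ^^ Suc n"
    using assms by (auto simp: gdist_eq_enat_iff adj_rel_def)
  then have "gdist H r w \<le> enat (Suc n)" unfolding gdist_le_enat_iff by blast
  then show ?thesis using enat by (simp add: one_enat_def)
qed simp

lemma parent_exists: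
  assumes "gdist H r w = enat (Suc n)"
  shows "\<exists>u. gdist H r u = enat n \<and> {u, w} \<in> edges H"
proof -
  obtain u where u: "(r, u) \<in> adj_rel H ^^ n" "{u, w} \<in> edges H"
    using assms by (auto simp: gdist_eq_enat_iff adj_rel_def)
  have "gdist H r u \<le> enat n" using u by (auto simp: gdist_le_enat_iff)
  moreover have "enat (Suc n) \<le> gdist H r u + 1" using gdist_edge_le[OF u(2)] assms by metis
  ultimately have "gdist H r u = enat n"
    by (cases "gdist H r u") (auto simp: one_enat_def)
  then show ?thesis using u by blast
qed

text \<open>Two vertices of the same generation that are joined by a path avoiding all earlier
  generations would close a cycle: extend the path by the parents of its endpoints until the two
  ancestral lines meet.\<close>

lemma no_path_above_generation:
  assumes "cycle_free H"
  assumes "gdist H r u = enat n" "gdist H r w = enat n" "u \<noteq> w"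
  assumes "p \<noteq> []" "hd p = u" "last p = w" "distinct p"
    and "successively (\<lambda>x y. {x, y} \<in> edges H) p"
    and "\<forall>x\<in>set p. enat n \<le> gdist H r x"
  shows False
  using assms(2-)
proof (induction n arbitrary: u w p)
  case 0
  then show ?case by (simp add: gdist_0_iff flip: zero_enat_def)
next
  case (Suc n)
  obtain u' where u': "gdist H r u' = enat n" "{u', u} \<in> edges H"
    using parent_exists Suc.prems(1) by blast
  obtain w' where w': "gdist H r w' = enat n" "{w', w} \<in> edges H"
    using parent_exists Suc.prems(2) by blast
  have notin: "u' \<notin> set p" "w' \<notin> set p" using Suc.prems(9) u'(1) w'(1) by auto
  have u'p: "successively (\<lambda>x y. {x, y} \<in> edges H) (u' # p)"
    using Suc.prems u' by (auto simp: successively_Cons)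
  show ?case
  proof (cases "u' = w'")
    case True
    let ?c = "u' # p"
    have "length p \<noteq> 1" using Suc.prems by (auto simp: length_Suc_conv)
    then have len: "3 \<le> length ?c" using \<open>p \<noteq> []\<close> by (cases p) (auto simp: Suc_le_eq)
    have "{?c ! i, ?c ! (Suc i mod length ?c)} \<in> edges H" if "i < length ?c" for i
    proof (cases "Suc i < length ?c")
      case True
      then show ?thesis using u'p successively_conv_nth[of _ ?c] by auto
    next
      case False
      then have i: "i = length p" using that by simp
      then have "?c ! i = w" using Suc.prems by (simp add: last_conv_nth nth_Cons')
      then show ?thesis using i w' True by (simp add: insert_commute)
    qed
    moreover have "distinct ?c" using Suc.prems notin by simp
    ultimately show False using assms(1) len unfolding cycle_free_def by blast
  next
    case False
    let ?p = "u' # p @ [w']"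
    have "successively (\<lambda>x y. {x, y} \<in> edges H) ?p"
      using u'p Suc.prems w' by (auto simp: successively_append_iff successively_Cons insert_commute)
    moreover have "distinct ?p" using Suc.prems notin False by auto
    moreover have "enat n \<le> enat (Suc n)" by simp
    then have "\<forall>x\<in>set ?p. enat n \<le> gdist H r x" using Suc.prems(9) u' w'
      by (metis Un_iff empty_iff empty_set order.refl order_trans set_ConsD set_append)
    ultimately show False using Suc.IH[OF u'(1) w'(1) False, of ?p] by simp
  qed
qed

lemma tree_no_edge_within_generation:
  assumes "cycle_free H" "simple_graph H" "{v, w} \<in> edges H" "gdist H r v = enat n"
  shows "gdist H r w \<noteq> enat n"
  using no_path_above_generation[of H r v n w "[v, w]"] edge_verts(3)[OF assms(2,3)] assms by auto

lemma tree_parent_unique: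
  assumes "cycle_free H" "gdist H r u = enat n" "gdist H r w = enat n"
    and "{u, v} \<in> edges H" "{w, v} \<in> edges H" "gdist H r v = enat (Suc n)"
  shows "u = w"
proof (rule ccontr)
  assume "u \<noteq> w"
  moreover have "enat n \<le> enat (Suc n)" by simp
  ultimately show False
    using no_path_above_generation[of H r u n w "[u, v, w]"] assms
    by (cases "u = v \<or> v = w") (auto simp: insert_commute)
qed

text \<open>Adjacent vertices of a tree lie in consecutive generations, and no vertex has two neighbours in
  the previous one; both follow from the absence of paths above a generation.\<close>

lemma tree_offspring:
  assumes "is_tree T" "vroot T \<in> verts T"
  shows offspring_root: "offspring T (vroot T) = nbrs T (vroot T)"
    and root_not_offspring: "vroot T \<notin> offspring T v"
    and has_parent: "w \<in> verts T \<Longrightarrow> w \<noteq> vroot T \<Longrightarrow> \<exists>u. w \<in> offspring T u"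
    and offspring_disjoint: "w \<in> offspring T u \<Longrightarrow> w \<in> offspring T v \<Longrightarrow> u = v"
    and nbrs_eq_insert_parent:
      "v \<in> offspring T u \<Longrightarrow> nbrs T v = insert u (offspring T v) \<and> u \<notin> offspring T v"
proof -
  let ?d = "gdist T (vroot T)"
  have T: "simple_graph T" "connected_graph T" "cycle_free T"
    using assms by (auto simp: is_tree_def)
  have fin: "\<exists>n. ?d v = enat n" if "v \<in> verts T" for v
    using gdist_finite_if_reachable T(2) assms(2) that unfolding connected_graph_def by blast
  have nfin: "\<exists>n. ?d v = enat n \<and> v \<in> verts T" if "v \<in> nbrs T u" for u v
    using fin nbrs_subset_verts[OF T(1)] that by blast
  have nbr_cases: "(\<exists>n. ?d v = enat n \<and> ?d w = enat (Suc n)) \<or> (\<exists>n. ?d w = enat n \<and> ?d v = enat (Suc n))"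
    if w: "w \<in> nbrs T v" for v w
  proof -
    obtain n m where nm: "?d w = enat n" "?d v = enat m"
      using nfin[of w v] nfin[of v w] w nbrs_commute[of w T v] by metis
    have e: "{v, w} \<in> edges T" using w by (simp add: nbrs_def)
    have "n \<noteq> m" using tree_no_edge_within_generation[OF T(3,1) e] nm by auto
    moreover have "n \<le> m + 1" "m \<le> n + 1"
      using gdist_edge_le[OF e, of "vroot T"] gdist_edge_le[of w v T "vroot T"] e nm
      by (auto simp: insert_commute one_enat_def)
    ultimately show ?thesis using nm by (cases "n < m") auto
  qed
  show "offspring T (vroot T) = nbrs T (vroot T)"
    using nbr_cases[of _ "vroot T"]
    by (fastforce simp: offspring_def one_enat_def zero_enat_def)
  show "vroot T \<notin> offspring T v"
    by (auto simp: offspring_def)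
  show "\<exists>u. w \<in> offspring T u" if w: "w \<in> verts T" "w \<noteq> vroot T" for w
  proof -
    obtain n where n: "?d w = enat n" using fin w by blast
    then obtain m where m: "n = Suc m" using w
      by (cases n) (auto simp: gdist_0_iff zero_enat_def[symmetric])
    obtain u where "?d u = enat m" "{u, w} \<in> edges T" using parent_exists n m by blast
    then have "w \<in> offspring T u" using n m by (simp add: offspring_def nbrs_def one_enat_def)
    then show ?thesis by blast
  qed
  show uniq: "u = v" if "w \<in> offspring T u" "w \<in> offspring T v" for u v w
  proof -
    have w: "w \<in> nbrs T u" "w \<in> nbrs T v" using that by (auto simp: offspring_def)
    obtain n where n: "?d u = enat n" using nfin[of u w] w nbrs_commute by blast
    have dw: "?d w = enat (Suc n)" using that(1) n by (simp add: offspring_def one_enat_def)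
    obtain m where m: "?d v = enat m" using nfin[of v w] w nbrs_commute by blast
    have "?d v = enat n" using that(2) m dw by (simp add: offspring_def one_enat_def)
    with n dw w show ?thesis using tree_parent_unique[OF T(3), of "vroot T" u n v w]
      by (simp add: nbrs_def)
  qed
  show "nbrs T v = insert u (offspring T v) \<and> u \<notin> offspring T v" if v: "v \<in> offspring T u"
  proof -
    obtain n where n: "?d u = enat n" using nfin[of u v] v nbrs_commute[of u T v]
      by (auto simp: offspring_def)
    have dv: "?d v = enat (Suc n)" using v n by (simp add: offspring_def one_enat_def)
    have "w = u \<or> w \<in> offspring T v" if w: "w \<in> nbrs T v" for w
      using nbr_cases[OF w]
    proof
      assume "\<exists>n. ?d v = enat n \<and> ?d w = enat (Suc n)"
      then show ?thesis using w by (auto simp: offspring_def one_enat_def)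
    next
      assume "\<exists>n. ?d w = enat n \<and> ?d v = enat (Suc n)"
      then have "v \<in> offspring T w" using w nbrs_commute by (auto simp: offspring_def one_enat_def)
      then show ?thesis using uniq v by blast
    qed
    moreover have "u \<in> nbrs T v" using v nbrs_commute by (auto simp: offspring_def)
    moreover have "u \<notin> offspring T v" using n dv by (auto simp: offspring_def one_enat_def)
    moreover have "offspring T v \<subseteq> nbrs T v" by (auto simp: offspring_def)
    ultimately show ?thesis by blast
  qed
qed

section \<open>Breadth-first labelled trees\<close>

text \<open>In a breadth-first labelled tree with offspring numbers \<open>f\<close>, the children of the vertices below
  \<open>v\<close> carry the labels from 1 to this number.\<close>

definition first_label :: "(nat \<Rightarrow> nat) \<Rightarrow> nat \<Rightarrow> nat" where
  "first_label f v = (\<Sum>u<v. f u)"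

text \<open>The properties that the limiting tree has almost surely in the non-backtracking setting. Membership in
  \<open>rgraphs\<close> contributes local finiteness.\<close>

definition regular_bfs_tree :: "rgraph \<Rightarrow> bool" where
  "regular_bfs_tree T \<longleftrightarrow> T \<in> rgraphs \<and> is_tree T \<and> bfs_labelled T \<and> (\<forall>v. 1 \<le> noff T v)"

lemma finite_initial_segment:
  fixes A :: "nat set"
  assumes "finite A" "0 \<notin> A" "\<And>x y. y \<in> A \<Longrightarrow> 1 \<le> x \<Longrightarrow> x \<le> y \<Longrightarrow> x \<in> A"
  shows "A = {1..card A}"
proof (cases "A = {}")
  case False
  have "A = {1..Max A}"
  proof (intro set_eqI iffI)
    fix x assume "x \<in> A"
    then show "x \<in> {1..Max A}" using assms(1,2) by (cases x) auto
  next
    fix x assume "x \<in> {1..Max A}"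
    then show "x \<in> A" using assms(3)[of "Max A" x] Max_in[OF assms(1) False] by simp
  qed
  moreover from this have "card A = Max A" by (metis card_atLeastAtMost diff_Suc_1 One_nat_def)
  ultimately show ?thesis by simp
qed simp

lemma
  assumes "regular_bfs_tree T"
  shows regular_root: "vroot T = 0"
    and regular_verts: "verts T = UNIV"
    and regular_finite_offspring: "finite (offspring T v)"
    and regular_noff_pos: "1 \<le> noff T v"
    and regular_offspring_nonempty: "offspring T v \<noteq> {}"
    and regular_deg_root: "deg T 0 = noff T 0"
    and regular_deg: "v \<noteq> 0 \<Longrightarrow> deg T v = noff T v + 1"
proof -
  show r: "vroot T = 0" and v: "verts T = UNIV"
    using assms by (auto simp: regular_bfs_tree_def bfs_labelled_def)
  have fn: "finite (nbrs T v)" for v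
    using assms v by (auto simp: regular_bfs_tree_def rgraphs_def locally_finite_def)
  show fo: "finite (offspring T v)" for v
    by (rule finite_subset[OF _ fn[of v]]) (auto simp: offspring_def)
  show n1: "1 \<le> noff T v" for v using assms by (auto simp: regular_bfs_tree_def)
  show "offspring T v \<noteq> {}" using n1[of v] by (auto simp: noff_def)
  have t: "is_tree T" "vroot T \<in> verts T" using assms v by (auto simp: regular_bfs_tree_def)
  show "deg T 0 = noff T 0" using offspring_root[OF t] r by (simp add: deg_def noff_def)
  show "deg T v = noff T v + 1" if nz: "v \<noteq> 0"
  proof -
    obtain u where "v \<in> offspring T u" using has_parent[OF t, of v] v r nz by auto
    from nbrs_eq_insert_parent[OF t this] show ?thesis
      using fo[of v] by (simp add: deg_def noff_def)
  qed
qed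

text \<open>The children of the vertices below \<open>v\<close> receive the smallest nonzero labels, because every
  nonzero label is a child and families are listed in the order of the parents. Hence the sizes
  of these families determine the labels that they occupy.\<close>

lemma regular_offspring:
  assumes T: "regular_bfs_tree T"
  shows "offspring T v = {first_label (noff T) v <.. first_label (noff T) (Suc v)}"
proof -
  have t: "is_tree T" "vroot T \<in> verts T" using assms regular_verts[OF T]
    by (auto simp: regular_bfs_tree_def)
  have ord: "x < y" if "u < v" "x \<in> offspring T u" "y \<in> offspring T v" for u v x y
    using T that by (auto simp: regular_bfs_tree_def bfs_labelled_def)
  have interval_diff: "{1..b} - {1..a} = {a<..b}" for a b :: nat by auto
  define U where "U v = (\<Union>u<v. offspring T u)" for v
  have U: "U v = {1..first_label (noff T) v}" for v
  proof -
    have disj: "disjoint_family_on (offspring T) {..<v}"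
      using offspring_disjoint[OF t] by (auto simp: disjoint_family_on_def)
    have "card (U v) = first_label (noff T) v"
      unfolding U_def first_label_def noff_def
      by (rule card_UN_disjoint) (use regular_finite_offspring[OF T] disj in \<open>auto simp: disjoint_family_on_def\<close>)
    moreover have "U v = {1..card (U v)}"
    proof (rule finite_initial_segment)
      show "finite (U v)" using regular_finite_offspring[OF T] by (simp add: U_def)
      show "0 \<notin> U v" using root_not_offspring[OF t] regular_root[OF T] by (auto simp: U_def)
      fix x y assume y: "y \<in> U v" and x: "1 \<le> x" "x \<le> y"
      obtain u where u: "x \<in> offspring T u"
        using has_parent[OF t, of x] regular_verts[OF T] regular_root[OF T] x by auto
      obtain u' where u': "u' < v" "y \<in> offspring T u'" using y by (auto simp: U_def)
      have "u < v"
      proof (rule ccontr)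
        assume "\<not> u < v"
        then have "y < x" using ord[of u' u y x] u u' by simp
        then show False using x by simp
      qed
      then show "x \<in> U v" using u by (auto simp: U_def)
    qed
    ultimately show ?thesis by simp
  qed
  have "offspring T v = U (Suc v) - U v"
  proof -
    have "offspring T v \<inter> U v = {}" using offspring_disjoint[OF t] by (fastforce simp: U_def)
    moreover have "U (Suc v) = offspring T v \<union> U v" by (auto simp: U_def less_Suc_eq)
    ultimately show ?thesis by blast
  qed
  also have "\<dots> = {first_label (noff T) v <.. first_label (noff T) (Suc v)}"
    unfolding U by (rule interval_diff)
  finally show ?thesis .
qed

lemma regular_nbrs_root:
  assumes "regular_bfs_tree T" shows "nbrs T 0 = {1..deg T 0}"
proof -
  have "nbrs T 0 = offspring T 0"
    using offspring_root[of T] assms regular_root[OF assms] regular_verts[OF assms]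
    by (auto simp: regular_bfs_tree_def)
  also have "\<dots> = {1..deg T 0}"
    unfolding regular_offspring[OF assms] first_label_def regular_deg_root[OF assms] set_eq_iff
    by (simp add: Suc_le_eq)
  finally show ?thesis .
qed

section \<open>Measurability on the space of rooted graphs\<close>

lemma rgraphsD:
  assumes "T \<in> rgraphs"
  shows "simple_graph T" "vroot T \<in> verts T" "connected_graph T" "finite (nbrs T v)"
  using assms nbrs_outside[of T v] by (auto simp: rgraphs_def locally_finite_def)

lemma space_rgraph_space [simp]: "space rgraph_space = rgraphs"
  unfolding rgraph_space_def by (rule space_measure_of) auto

lemma rgraph_space_generators:
  "{T \<in> rgraphs. v \<in> verts T} \<in> sets rgraph_space"
  "{T \<in> rgraphs. {v, w} \<in> edges T} \<in> sets rgraph_space"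
  "{T \<in> rgraphs. vroot T = v} \<in> sets rgraph_space"
proof -
  have "sets rgraph_space = sigma_sets rgraphs
     ((\<lambda>v. {H \<in> rgraphs. v \<in> verts H}) ` UNIV \<union>
      (\<lambda>(v, w). {H \<in> rgraphs. {v, w} \<in> edges H}) ` UNIV \<union>
      (\<lambda>v. {H \<in> rgraphs. vroot H = v}) ` UNIV)"
    unfolding rgraph_space_def by (rule sets_measure_of) auto
  then show
    "{T \<in> rgraphs. v \<in> verts T} \<in> sets rgraph_space"
    "{T \<in> rgraphs. {v, w} \<in> edges T} \<in> sets rgraph_space"
    "{T \<in> rgraphs. vroot T = v} \<in> sets rgraph_space"
    by (auto intro!: sigma_sets.Basic)
qed

lemma measurable_verts [measurable]: "Measurable.pred rgraph_space (\<lambda>T. v \<in> verts T)"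
  and measurable_edges [measurable]: "Measurable.pred rgraph_space (\<lambda>T. {v, w} \<in> edges T)"
  unfolding pred_def using rgraph_space_generators by auto

lemma measurable_vroot [measurable]: "vroot \<in> rgraph_space \<rightarrow>\<^sub>M count_space UNIV"
  unfolding measurable_count_space_eq2_countable
proof (intro conjI ballI)
  fix r
  have "vroot -` {r} \<inter> space rgraph_space = {T \<in> rgraphs. vroot T = r}" by auto
  then show "vroot -` {r} \<inter> space rgraph_space \<in> sets rgraph_space"
    using rgraph_space_generators(3) by simp
qed auto

lemma measurable_mem_nbrs [measurable]: "Measurable.pred rgraph_space (\<lambda>T. w \<in> nbrs T v)"
  by (simp add: nbrs_def)

lemma measurable_deg [measurable]: "(\<lambda>T. deg T v) \<in> rgraph_space \<rightarrow>\<^sub>M count_space UNIV"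
  unfolding deg_def by (rule measurable_card) (use measurable_mem_nbrs in \<open>simp add: pred_def\<close>)

lemma measurable_deg_root [measurable]:
  "(\<lambda>T. deg T (vroot T)) \<in> rgraph_space \<rightarrow>\<^sub>M count_space UNIV"
  by (rule measurable_compose_countable[OF measurable_deg measurable_vroot])

lemma measurable_adj_relpow [measurable]:
  "Measurable.pred rgraph_space (\<lambda>T. (v, w) \<in> adj_rel T ^^ n)"
proof (induction n arbitrary: w)
  case (Suc n)
  note [measurable] = Suc.IH
  have eq: "(\<lambda>T. (v, w) \<in> adj_rel T ^^ Suc n) =
    (\<lambda>T. \<exists>u. (v, u) \<in> adj_rel T ^^ n \<and> {u, w} \<in> edges T)"
    by (auto simp: adj_rel_def)
  show ?case unfolding eq by measurable
qed simp

lemma measurable_gdist [measurable]: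
  "(\<lambda>T. gdist T v w) \<in> rgraph_space \<rightarrow>\<^sub>M count_space UNIV"
proof -
  have *: "Measurable.pred rgraph_space (\<lambda>T. gdist T v w = enat n)" for n
    unfolding gdist_eq_enat_iff by measurable
  have "Measurable.pred rgraph_space (\<lambda>T. gdist T v w = e)" for e
  proof (cases e)
    case (enat n) then show ?thesis using * by simp
  next
    case infinity
    have eq: "(\<lambda>T. gdist T v w = e) = (\<lambda>T. \<forall>n. \<not> gdist T v w = enat n)"
      unfolding infinity by (simp only: not_infinity_eq[symmetric] flip: not_ex) simp
    note [measurable] = *
    show ?thesis unfolding eq by measurable
  qed
  then have "{T \<in> rgraphs. gdist T v w = e} \<in> sets rgraph_space" for e
    unfolding pred_def by simp
  then show ?thesis unfolding measurable_count_space_eq2_countable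
    by (simp add: vimage_def Int_def conj_commute)
qed

lemma measurable_mem_offspring [measurable]:
  "Measurable.pred rgraph_space (\<lambda>T. w \<in> offspring T v)"
proof -
  have [measurable]: "(\<lambda>T. gdist T (vroot T) u) \<in> rgraph_space \<rightarrow>\<^sub>M count_space UNIV" for u
    by (rule measurable_compose_countable[OF measurable_gdist measurable_vroot])
  have "(\<lambda>T. w \<in> offspring T v) = (\<lambda>T. w \<in> nbrs T v \<and>
      (\<exists>e. gdist T (vroot T) v = e \<and> gdist T (vroot T) w = e + 1))"
    by (auto simp: offspring_def)
  then show ?thesis by (simp only:) measurable
qed

lemma finite_set_walk_law: "finite (set_pmf (walk_law S r k))"
  by (induction k) auto

lemma pmf_walk_law_Suc:
  "pmf (walk_law S r (Suc k)) j =
    (\<Sum>v. pmf (walk_law S r k) v *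
      (if finite (S v) \<and> S v \<noteq> {} then indicator (S v) j / real (card (S v)) else indicator {v} j))"
proof -
  let ?K = "\<lambda>v. if finite (S v) \<and> S v \<noteq> {} then pmf_of_set (S v) else return_pmf v"
  let ?A = "set_pmf (walk_law S r k)"
  have "pmf (walk_law S r (Suc k)) j = (\<Sum>v\<in>?A. pmf (?K v) j * pmf (walk_law S r k) v)"
    by (simp add: pmf_bind integral_measure_pmf_real[OF finite_set_walk_law])
  also have "\<dots> = (\<Sum>v. pmf (?K v) j * pmf (walk_law S r k) v)"
    by (rule suminf_finite[symmetric]) (auto simp: finite_set_walk_law set_pmf_iff)
  also have "\<dots> = (\<Sum>v. pmf (walk_law S r k) v *
      (if finite (S v) \<and> S v \<noteq> {} then indicator (S v) j / real (card (S v)) else indicator {v} j))"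
    by (intro arg_cong[where f=suminf] ext) (auto simp: indicator_def)
  finally show ?thesis .
qed

text \<open>The law of the walk on a random graph is measurable because each step is a countable sum of
  products of measurable quantities.\<close>

lemma measurable_walk_law:
  assumes S: "\<And>v w. Measurable.pred rgraph_space (\<lambda>T. w \<in> S T v)"
  shows "(\<lambda>T. pmf (walk_law (S T) (vroot T) k) j) \<in> borel_measurable rgraph_space"
proof (induction k arbitrary: j)
  case 0
  have "(\<lambda>T. pmf (walk_law (S T) (vroot T) 0) j) = (\<lambda>T. if vroot T = j then 1 else 0)"
    by (auto simp: fun_eq_iff indicator_def)
  then show ?case by simp
next
  case (Suc k)
  note [measurable] = Suc.IH S
  have S': "{T \<in> space rgraph_space. w \<in> S T v} \<in> sets rgraph_space" for v w
    using S by (simp add: pred_def)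
  have [measurable]: "Measurable.pred rgraph_space (\<lambda>T. finite (S T v))"
    "(\<lambda>T. card (S T v)) \<in> rgraph_space \<rightarrow>\<^sub>M count_space UNIV" for v
    by (intro measurable_finite measurable_card S')+
  have "Measurable.pred rgraph_space (\<lambda>T. \<exists>w. w \<in> S T v)" for v by measurable
  then have [measurable]: "Measurable.pred rgraph_space (\<lambda>T. S T v \<noteq> {})" for v
    by (simp add: ex_in_conv)
  have [measurable]: "(\<lambda>T. indicator (S T v) j :: real) \<in> borel_measurable rgraph_space" for v
  proof -
    have "(\<lambda>T. indicator (S T v) j :: real) = (\<lambda>T. if j \<in> S T v then 1 else 0)"
      by (auto simp: fun_eq_iff)
    then show ?thesis by simp
  qed
  show ?case unfolding pmf_walk_law_Suc by measurable
qed

text \<open>The sum over the random vertex set is replaced by one over all labels, since other labels have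
  degree 0; it is a finite sum, as the walk visits finitely many vertices up to time \<open>k\<close>.\<close>

lemma bias_eq_suminf:
  assumes "T \<in> rgraphs"
  shows "bias S k T = (\<Sum>j. pmf (walk_law (S T) (vroot T) k) j * real (deg T j)) - real (deg T (vroot T))"
    and "bias S k T = (\<Sum>j\<in>set_pmf (walk_law (S T) (vroot T) k).
      pmf (walk_law (S T) (vroot T) k) j * real (deg T j)) - real (deg T (vroot T))"
proof -
  let ?p = "walk_law (S T) (vroot T) k"
  let ?f = "\<lambda>j. pmf ?p j * real (deg T j)"
  have z: "deg T j = 0" if "j \<notin> verts T" for j
    using nbrs_outside[OF rgraphsD(1)[OF assms] that] by (simp add: deg_def)
  have "(\<Sum>\<^sub>\<infinity>j\<in>verts T. ?f j) = (\<Sum>\<^sub>\<infinity>j\<in>set_pmf ?p. ?f j)"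
    by (rule infsum_cong_neutral) (auto simp: z set_pmf_iff)
  also have "\<dots> = (\<Sum>j\<in>set_pmf ?p. ?f j)" by (simp add: finite_set_walk_law)
  finally have *: "(\<Sum>\<^sub>\<infinity>j\<in>verts T. ?f j) = (\<Sum>j\<in>set_pmf ?p. ?f j)" .
  then show "bias S k T = (\<Sum>j\<in>set_pmf ?p. ?f j) - real (deg T (vroot T))" by (simp add: bias_def)
  moreover have "(\<Sum>j. ?f j) = (\<Sum>j\<in>set_pmf ?p. ?f j)"
    by (rule suminf_finite) (auto simp: finite_set_walk_law set_pmf_iff)
  ultimately show "bias S k T = (\<Sum>j. ?f j) - real (deg T (vroot T))" by simp
qed

lemma measurable_bias:
  assumes "\<And>v w. Measurable.pred rgraph_space (\<lambda>T. w \<in> S T v)"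
  shows "bias S k \<in> borel_measurable rgraph_space"
proof -
  note [measurable] = measurable_walk_law[of S, OF assms]
  have "(\<lambda>T. (\<Sum>j. pmf (walk_law (S T) (vroot T) k) j * real (deg T j)) - real (deg T (vroot T)))
    \<in> borel_measurable rgraph_space" by measurable
  then show ?thesis
    by (subst measurable_cong[OF bias_eq_suminf(1)]) simp_all
qed

lemma measurable_nonbacktracking_bias [measurable]:
  "nonbacktracking_bias k \<in> borel_measurable rgraph_space"
  unfolding nonbacktracking_bias_def by (rule measurable_bias) measurable

lemma measurable_backtracking_bias [measurable]:
  "backtracking_bias k \<in> borel_measurable rgraph_space"
  unfolding backtracking_bias_def by (rule measurable_bias) measurable

lemma measurable_sum_verts:
  assumes [measurable]: "\<And>j. f j \<in> borel_measurable rgraph_space"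
  shows "(\<lambda>T. \<Sum>j\<in>verts T. f j T :: real) \<in> borel_measurable rgraph_space"
proof -
  have "(\<Sum>j\<in>verts T. f j T) =
      (if finite (verts T) then \<Sum>j. if j \<in> verts T then f j T else 0 else 0)" for T
    using suminf_finite[of "verts T" "\<lambda>j. if j \<in> verts T then f j T else 0"] by auto
  moreover have [measurable]: "Measurable.pred rgraph_space (\<lambda>T. finite (verts T))"
    by (rule measurable_finite) (use rgraph_space_generators(1) in simp)
  ultimately show ?thesis by simp
qed

lemma measurable_stationary_bias [measurable]:
  "stationary_bias \<in> borel_measurable rgraph_space"
  unfolding stationary_bias_def[abs_def]
  by (intro borel_measurable_diff borel_measurable_divide measurable_sum_verts) measurable

section \<open>Mass transport in the local limit\<close>

text \<open>The number of ordered adjacent pairs \<open>(v, w)\<close> with degrees \<open>(a, b)\<close> that start at a given \<open>v\<close>. As a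
  function of the root it is bounded by \<open>a\<close> and depends on the ball of radius 2 only.\<close>

definition joint_degree_count :: "nat \<Rightarrow> nat \<Rightarrow> 'z ugraph_scheme \<Rightarrow> nat \<Rightarrow> real" where
  "joint_degree_count a b H v =
    (if deg H v = a then real (card {w \<in> nbrs H v. deg H w = b}) else 0)"

lemma joint_degree_count_swap:
  assumes "finite (verts H)" "simple_graph H"
  shows "(\<Sum>v\<in>verts H. joint_degree_count a b H v) = (\<Sum>v\<in>verts H. joint_degree_count b a H v)"
proof -
  have *: "joint_degree_count a b H v =
      (\<Sum>w\<in>verts H. of_bool (w \<in> nbrs H v \<and> deg H v = a \<and> deg H w = b))" for a b v
  proof -
    have "{w \<in> nbrs H v. deg H w = b} = {w \<in> verts H. w \<in> nbrs H v \<and> deg H w = b}"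
      using nbrs_subset_verts[OF assms(2)] by blast
    then show ?thesis
      using assms(1) by (simp add: joint_degree_count_def sum.If_cases of_bool_def Int_def)
  qed
  show ?thesis unfolding * 
    by (subst sum.swap) (intro sum.cong refl arg_cong[where f=of_bool], auto simp: nbrs_commute)
qed

lemma nbrs_induced_rooted:
  "v \<in> A \<Longrightarrow> nbrs (induced_rooted H A r) v = nbrs H v \<inter> A"
  by (auto simp: nbrs_def induced_rooted_def)

lemma joint_degree_count_component:
  assumes "simple_graph H" "i \<in> verts H"
  shows "joint_degree_count a b (component_at H i) i = joint_degree_count a b H i"
proof -
  let ?A = "{v \<in> verts H. (i, v) \<in> (adj_rel H)\<^sup>*}"
  have "nbrs H v \<subseteq> ?A" if "v \<in> ?A" for v
    using that nbrs_subset_verts[OF assms(1), of v]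
    by (auto simp: nbrs_def adj_rel_def intro: rtrancl_into_rtrancl)
  then have nb: "nbrs (component_at H i) v = nbrs H v" if "v \<in> ?A" for v
    using that nbrs_induced_rooted[of v ?A H i] by (auto simp: component_at_def)
  have i: "i \<in> ?A" using assms by simp
  have "deg (component_at H i) v = deg H v" if "v \<in> ?A" for v
    using nb[OF that] by (simp add: deg_def)
  moreover have "nbrs H i \<subseteq> ?A" using nb[OF i] i nbrs_induced_rooted[OF i, of H i]
    by (auto simp: component_at_def)
  ultimately show ?thesis using nb[OF i] i
    by (auto simp: joint_degree_count_def intro!: arg_cong[where f=card])
qed

lemma vroot_component_at [simp]: "vroot (component_at H i) = i"
  by (simp add: component_at_def induced_rooted_def)

lemma verts_rball: "verts (rball r H) = {v \<in> verts H. gdist H (vroot H) v \<le> enat r}"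
  and edges_rball: "v \<in> verts (rball r H) \<Longrightarrow> w \<in> verts (rball r H) \<Longrightarrow>
    {v, w} \<in> edges (rball r H) \<longleftrightarrow> {v, w} \<in> edges H"
  and vroot_rball: "vroot (rball r H) = vroot H"
  by (auto simp: rball_def induced_rooted_def)

text \<open>Below the boundary of the ball no neighbour is cut off, so an isomorphism of balls preserves
  degrees there.\<close>

lemma rball_iso_nbrs:
  assumes "H \<in> rgraphs" "K \<in> rgraphs"
    and f: "bij_betw f (verts (rball r H)) (verts (rball r K))"
      "\<forall>v\<in>verts (rball r H). \<forall>w\<in>verts (rball r H).
         {v, w} \<in> edges (rball r H) \<longleftrightarrow> {f v, f w} \<in> edges (rball r K)"
    and v: "v \<in> verts H" "gdist H (vroot H) v < enat r" "gdist K (vroot K) (f v) < enat r"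
  shows "f ` nbrs H v = nbrs K (f v)" "inj_on f (nbrs H v)" "deg K (f v) = deg H v"
proof -
  have near: "nbrs L u \<subseteq> verts (rball r L)" if "L \<in> rgraphs" "gdist L (vroot L) u < enat r" for L u
  proof
    fix w assume w: "w \<in> nbrs L u"
    have "gdist L (vroot L) w \<le> gdist L (vroot L) u + 1"
      using w by (intro gdist_edge_le) (simp add: nbrs_def)
    also have "\<dots> \<le> enat r" using that(2) by (simp add: ileI1 plus_1_eSuc)
    finally show "w \<in> verts (rball r L)"
      using w nbrs_subset_verts[OF rgraphsD(1)[OF that(1)]] by (auto simp: verts_rball)
  qed
  have vB: "v \<in> verts (rball r H)" using v by (simp add: verts_rball)
  have fB: "f u \<in> verts (rball r K)" if "u \<in> verts (rball r H)" for u
    using f(1) that by (auto simp: bij_betw_def)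
  have adj: "w \<in> nbrs H v \<longleftrightarrow> f w \<in> nbrs K (f v)" if "w \<in> verts (rball r H)" for w
    using f(2) vB that fB edges_rball by (simp add: nbrs_def)
  show inj: "inj_on f (nbrs H v)"
    using f(1) near[OF assms(1) v(2)] by (auto simp: bij_betw_def intro: inj_on_subset)
  show im: "f ` nbrs H v = nbrs K (f v)"
  proof
    show "f ` nbrs H v \<subseteq> nbrs K (f v)" using adj near[OF assms(1) v(2)] by blast
    show "nbrs K (f v) \<subseteq> f ` nbrs H v"
    proof
      fix w' assume w': "w' \<in> nbrs K (f v)"
      then obtain w where "w \<in> verts (rball r H)" "w' = f w"
        using near[OF assms(2) v(3)] f(1) by (auto simp: bij_betw_def)
      then show "w' \<in> f ` nbrs H v" using adj w' by blast
    qed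
  qed
  show "deg K (f v) = deg H v" unfolding deg_def im[symmetric] by (rule card_image[OF inj])
qed

lemma joint_degree_count_iso:
  assumes HK: "H \<in> rgraphs" "K \<in> rgraphs" and iso: "rgraph_iso (rball r H) (rball r K)" and r: "2 \<le> r"
  shows "joint_degree_count a b H (vroot H) = joint_degree_count a b K (vroot K)"
proof -
  obtain f where f: "bij_betw f (verts (rball r H)) (verts (rball r K))"
      "\<forall>v\<in>verts (rball r H). \<forall>w\<in>verts (rball r H).
         {v, w} \<in> edges (rball r H) \<longleftrightarrow> {f v, f w} \<in> edges (rball r K)"
    and root: "f (vroot H) = vroot K"
    using iso by (auto simp: rgraph_iso_def vroot_rball)
  have near: "gdist L (vroot L) v < enat r" if "v \<in> nbrs L (vroot L)" for L :: rgraph and v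
  proof -
    have "gdist L (vroot L) v \<le> 1"
      using gdist_edge_le[of "vroot L" v L "vroot L"] that by (simp add: nbrs_def)
    also have "1 < enat r" using r by (simp add: one_enat_def)
    finally show ?thesis .
  qed
  have root_near: "gdist L (vroot L) (vroot L) < enat r" for L :: rgraph
    using r by (simp add: zero_enat_def)
  note R = rball_iso_nbrs[OF HK f rgraphsD(2)[OF HK(1)], unfolded root, OF root_near root_near]
  have d: "deg K (f w) = deg H w" if "w \<in> nbrs H (vroot H)" for w
  proof (rule rball_iso_nbrs(3)[OF HK f])
    show "w \<in> verts H" using that nbrs_subset_verts[OF rgraphsD(1)[OF HK(1)]] by blast
    show "gdist H (vroot H) w < enat r" "gdist K (vroot K) (f w) < enat r"
      using near that R(1) by auto
  qed
  have "{w' \<in> nbrs K (vroot K). deg K w' = b} = f ` {w \<in> nbrs H (vroot H). deg H w = b}"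
    unfolding R(1)[symmetric] using d by auto
  moreover have "card (f ` {w \<in> nbrs H (vroot H). deg H w = b}) = card {w \<in> nbrs H (vroot H). deg H w = b}"
    by (rule card_image) (rule inj_on_subset[OF R(2)], auto)
  ultimately show ?thesis using R(3) by (simp add: joint_degree_count_def)
qed

text \<open>The radius 0 keeps the supremum in the definition of \<open>local_dist\<close> from being taken over the empty
  set, where it would be minus infinity.\<close>

lemma rgraph_iso_rball_0:
  assumes "H \<in> rgraphs" "K \<in> rgraphs" shows "rgraph_iso (rball 0 H) (rball 0 K)"
proof -
  have v: "verts (rball 0 L) = {vroot L}" if "L \<in> rgraphs" for L
    using rgraphsD(2)[OF that] by (auto simp: verts_rball gdist_0_iff simp flip: zero_enat_def)
  have e: "{x} \<notin> edges (rball 0 L)" if "L \<in> rgraphs" for x L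
    using edge_verts(3)[OF rgraphsD(1)[OF that], of x x] by (auto simp: rball_def induced_rooted_def)
  show ?thesis unfolding rgraph_iso_def
    by (rule exI[of _ "\<lambda>_. vroot K"]) (use assms v e in \<open>auto simp: vroot_rball bij_betw_def\<close>)
qed

lemma rgraph_iso_of_local_dist:
  assumes HK: "H \<in> rgraphs" "K \<in> rgraphs" and d: "local_dist H K < 1 / 2"
  shows "\<exists>r\<ge>2. rgraph_iso (rball r H) (rball r K)"
proof (rule ccontr)
  assume "\<not> ?thesis"
  then have le: "r \<le> 1" if "rgraph_iso (rball r H) (rball r K)" for r
    using that by (metis One_nat_def Suc_1 not_less_eq_eq)
  define S where "S = (SUP r\<in>{r. rgraph_iso (rball r H) (rball r K)}. ereal (real r))"
  have "S \<le> 1" unfolding S_def by (rule SUP_least) (use le in \<open>auto simp: one_ereal_def\<close>)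
  moreover have "0 \<le> S" unfolding S_def
    by (rule SUP_upper2[of 0]) (use rgraph_iso_rball_0[OF HK] in auto)
  ultimately obtain s where s: "S = ereal s" "0 \<le> s" "s \<le> 1"
    by (cases S) auto
  have "local_dist H K = 1 / (1 + s)"
    using s by (simp add: local_dist_def S_def[symmetric] one_ereal_def divide_inverse)
  also have "\<dots> \<ge> 1 / 2" using s by (simp add: field_simps)
  finally show False using d by simp
qed

lemma local_bdd_cont_joint_degree_count:
  "local_bdd_cont (\<lambda>T. joint_degree_count a b T (vroot T))"
  unfolding local_bdd_cont_def
proof (intro conjI ballI allI impI)
  have "\<bar>joint_degree_count a b T (vroot T)\<bar> \<le> real a" if "T \<in> rgraphs" for T
  proof -
    have "card {w \<in> nbrs T (vroot T). deg T w = b} \<le> deg T (vroot T)"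
      unfolding deg_def[of T "vroot T"] by (rule card_mono) (use rgraphsD(4)[OF that] in auto)
    then show ?thesis by (simp add: joint_degree_count_def)
  qed
  then show "bounded ((\<lambda>T. joint_degree_count a b T (vroot T)) ` rgraphs)"
    by (auto simp: bounded_iff)
  fix H and \<epsilon> :: real assume "H \<in> rgraphs" "0 < \<epsilon>"
  then show "\<exists>\<delta>>0. \<forall>K\<in>rgraphs. local_dist H K < \<delta> \<longrightarrow>
      \<bar>joint_degree_count a b K (vroot K) - joint_degree_count a b H (vroot H)\<bar> < \<epsilon>"
    using rgraph_iso_of_local_dist joint_degree_count_iso
    by (intro exI[of _ "1/2"]) (auto, metis abs_0 diff_self)
qed

lemma measurable_joint_degree_count [measurable]:
  "(\<lambda>T. joint_degree_count a b T (vroot T)) \<in> borel_measurable rgraph_space"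
proof -
  have "Measurable.pred rgraph_space (\<lambda>T. w \<in> {w \<in> nbrs T v. deg T w = b})" for v w by simp
  then have [measurable]: "(\<lambda>T. card {w \<in> nbrs T v. deg T w = b}) \<in> rgraph_space \<rightarrow>\<^sub>M count_space UNIV" for v
    by (intro measurable_card) (simp add: pred_def)
  have "(\<lambda>T. joint_degree_count a b T v) \<in> borel_measurable rgraph_space" for v
    unfolding joint_degree_count_def by measurable
  then show ?thesis by (rule measurable_compose_countable[OF _ measurable_vroot])
qed

lemma conv_in_prob_limit_unique:
  assumes P: "prob_space P" and X: "conv_in_prob P X (\<lambda>_. c)" and Y: "conv_in_prob P Y (\<lambda>_. d)"
    and meas: "\<forall>\<^sub>F n in sequentially. X n \<in> borel_measurable P \<and> Y n \<in> borel_measurable P"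
    and eq: "\<forall>\<^sub>F n in sequentially. AE x in P. X n x = Y n x"
  shows "c = d"
proof (rule ccontr)
  assume "c \<noteq> d"
  interpret prob_space P by fact
  define \<epsilon> where "\<epsilon> = \<bar>c - d\<bar> / 3"
  have \<epsilon>: "0 < \<epsilon>" using \<open>c \<noteq> d\<close> by (simp add: \<epsilon>_def)
  let ?X = "\<lambda>n. {x \<in> space P. \<epsilon> < \<bar>X n x - c\<bar>}" and ?Y = "\<lambda>n. {x \<in> space P. \<epsilon> < \<bar>Y n x - d\<bar>}"
  have "(\<lambda>n. prob (?X n) + prob (?Y n)) \<longlonglongrightarrow> 0 + 0"
    using X Y \<epsilon> unfolding conv_in_prob_def by (intro tendsto_add) auto
  moreover have "\<forall>\<^sub>F n in sequentially. 1 \<le> prob (?X n) + prob (?Y n)"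
    using meas eq
  proof eventually_elim
    case (elim n)
    then have [measurable]: "X n \<in> borel_measurable P" "Y n \<in> borel_measurable P" by auto
    have "AE x in P. x \<in> ?X n \<union> ?Y n"
      using elim(2) AE_space
    proof eventually_elim
      case (elim x)
      have "\<epsilon> < \<bar>X n x - c\<bar> \<or> \<epsilon> < \<bar>Y n x - d\<bar>"
      proof (rule ccontr)
        assume "\<not> ?thesis"
        then have "\<bar>X n x - c\<bar> \<le> \<epsilon>" "\<bar>Y n x - d\<bar> \<le> \<epsilon>" by auto
        moreover have "\<bar>c - d\<bar> \<le> \<bar>X n x - c\<bar> + \<bar>X n x - d\<bar>" by arith
        moreover have "\<bar>c - d\<bar> = 3 * \<epsilon>" by (simp add: \<epsilon>_def)
        ultimately show False using elim(1) \<epsilon> by simp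
      qed
      then show ?case using elim(2) by blast
    qed
    then have "1 = prob (?X n \<union> ?Y n)"
      by (subst prob_eq_1[THEN iffD2]) auto
    also have "\<dots> \<le> prob (?X n) + prob (?Y n)" by (rule measure_Un_le) auto
    finally show ?case .
  qed
  ultimately have "1 \<le> (0 :: real)" by (intro tendsto_lowerbound) auto
  then show False by simp
qed

lemma measurable_component_average:
  assumes "G \<in> P \<rightarrow>\<^sub>M count_space S"
  shows "(\<lambda>x. (\<Sum>i\<in>A. h (component_at (G x) i)) / real n) \<in> borel_measurable P"
  by (rule measurable_compose[OF assms]) simp

text \<open>Summed over all vertices of a finite graph, the two counts agree. Both averages therefore have the
  same limit in probability.\<close>

lemma local_limit_mass_transport:
  assumes P: "prob_space P"
    and G: "\<forall>n\<ge>3. G n \<in> measurable P (count_space {H. verts H = {1..n} \<and> simple_graph H})"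
    and conv: "local_conv_in_prob P G (\<lambda>_. L)"
  shows "(\<integral>T. joint_degree_count a b T (vroot T) \<partial>L) = (\<integral>T. joint_degree_count b a T (vroot T) \<partial>L)"
proof (rule conv_in_prob_limit_unique[OF P])
  let ?X = "\<lambda>a b n x. (\<Sum>i = 1..n. joint_degree_count a b (component_at (G n x) i) (vroot (component_at (G n x) i))) / real n"
  show "conv_in_prob P (?X a b) (\<lambda>_. \<integral>T. joint_degree_count a b T (vroot T) \<partial>L)"
    "conv_in_prob P (?X b a) (\<lambda>_. \<integral>T. joint_degree_count b a T (vroot T) \<partial>L)"
    using conv local_bdd_cont_joint_degree_count unfolding local_conv_in_prob_def by blast+
  have ev: "\<forall>\<^sub>F n in sequentially. (3::nat) \<le> n" by (rule eventually_ge_at_top)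
  show "\<forall>\<^sub>F n in sequentially. ?X a b n \<in> borel_measurable P \<and> ?X b a n \<in> borel_measurable P"
    using ev
  proof eventually_elim
    case (elim n)
    note meas = measurable_component_average[OF G[rule_format, OF elim]]
    from meas[of "\<lambda>T. joint_degree_count a b T (vroot T)"] meas[of "\<lambda>T. joint_degree_count b a T (vroot T)"]
    show ?case by blast
  qed
  show "\<forall>\<^sub>F n in sequentially. AE x in P. ?X a b n x = ?X b a n x"
    using ev
  proof eventually_elim
    case (elim n)
    show ?case
    proof (rule AE_I2)
      fix x assume "x \<in> space P"
      then have V: "verts (G n x) = {1..n}" and S: "simple_graph (G n x)"
        using measurable_space[OF G[rule_format, OF elim]] by auto
      then show "?X a b n x = ?X b a n x"
        using joint_degree_count_swap[of "G n x" a b] joint_degree_count_component[OF S] by simp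
    qed
  qed
qed

text \<open>For large \<open>n\<close>, almost surely no vertex of \<open>G n\<close> has a neighbour of degree below \<open>m\<close>, so the averages
  that converge to the integral vanish.\<close>

lemma local_limit_no_low_degree:
  assumes P: "prob_space P"
    and G: "\<forall>n\<ge>3. G n \<in> measurable P (count_space {H. verts H = {1..n} \<and> simple_graph H})"
    and conv: "local_conv_in_prob P G (\<lambda>_. L)"
    and min: "\<forall>\<^sub>F n in sequentially. AE x in P. \<forall>i\<in>{1..n}. m \<le> deg (G n x) i" and b: "b < m"
  shows "(\<integral>T. joint_degree_count a b T (vroot T) \<partial>L) = 0"
proof (rule conv_in_prob_limit_unique[OF P])
  let ?X = "\<lambda>n x. (\<Sum>i = 1..n. joint_degree_count a b (component_at (G n x) i) (vroot (component_at (G n x) i))) / real n"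
  show "conv_in_prob P ?X (\<lambda>_. \<integral>T. joint_degree_count a b T (vroot T) \<partial>L)"
    using conv local_bdd_cont_joint_degree_count unfolding local_conv_in_prob_def by blast
  show "conv_in_prob P (\<lambda>_ _. 0) (\<lambda>_. 0)" by (simp add: conv_in_prob_def)
  have ev: "\<forall>\<^sub>F n in sequentially. (3::nat) \<le> n" by (rule eventually_ge_at_top)
  show "\<forall>\<^sub>F n in sequentially. ?X n \<in> borel_measurable P \<and> (\<lambda>_. 0::real) \<in> borel_measurable P"
    using ev
  proof eventually_elim
    case (elim n)
    from measurable_component_average[OF G[rule_format, OF elim],
        of "\<lambda>T. joint_degree_count a b T (vroot T)"]
    show ?case by auto
  qed
  show "\<forall>\<^sub>F n in sequentially. AE x in P. ?X n x = 0"
    using ev min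
  proof eventually_elim
    case (elim n)
    from elim(2) AE_space show ?case
    proof eventually_elim
      case el: (elim x)
      then have V: "verts (G n x) = {1..n}" and S: "simple_graph (G n x)"
        using measurable_space[OF G[rule_format, OF elim(1)]] by auto
      have "{w \<in> nbrs (G n x) i. deg (G n x) w = b} = {}" for i
        using el(1) b nbrs_subset_verts[OF S, of i] V by fastforce
      then have "joint_degree_count a b (G n x) i = 0" for i
        by (simp only: joint_degree_count_def card.empty of_nat_0 if_cancel)
      then show ?case using joint_degree_count_component[OF S] V by simp
    qed
  qed
qed

section \<open>Size-biased degrees\<close>

lemma (in prob_space) nn_integral_nat_valued:
  fixes Y :: "'a \<Rightarrow> nat"
  assumes [measurable]: "Y \<in> M \<rightarrow>\<^sub>M count_space UNIV"
  shows "(\<integral>\<^sup>+ \<omega>. g (Y \<omega>) \<partial>M) = (\<Sum>a. g a * ennreal (prob {\<omega> \<in> space M. Y \<omega> = a}))"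
proof -
  have *: "(\<lambda>a. g a * indicator {\<omega> \<in> space M. Y \<omega> = a} \<omega>) = (\<lambda>a. if a = Y \<omega> then g a else 0)"
    if "\<omega> \<in> space M" for \<omega>
    using that by (auto simp: fun_eq_iff)
  have "(\<Sum>a. g a * indicator {\<omega> \<in> space M. Y \<omega> = a} \<omega>) = g (Y \<omega>)" if "\<omega> \<in> space M" for \<omega>
    unfolding *[OF that] by (subst suminf_finite[of "{Y \<omega>}"]) auto
  then have "(\<integral>\<^sup>+ \<omega>. g (Y \<omega>) \<partial>M)
      = (\<integral>\<^sup>+ \<omega>. (\<Sum>a. g a * indicator {\<omega> \<in> space M. Y \<omega> = a} \<omega>) \<partial>M)"
    by (intro nn_integral_cong) simp
  also have "\<dots> = (\<Sum>a. \<integral>\<^sup>+ \<omega>. g a * indicator {\<omega> \<in> space M. Y \<omega> = a} \<omega> \<partial>M)"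
    by (rule nn_integral_suminf) simp
  also have "\<dots> = (\<Sum>a. g a * ennreal (prob {\<omega> \<in> space M. Y \<omega> = a}))"
    by (simp add: nn_integral_cmult emeasure_eq_measure)
  finally show ?thesis .
qed

lemma (in prob_space) nat_valued_charges:
  fixes X :: "'a \<Rightarrow> nat"
  assumes [measurable]: "X \<in> M \<rightarrow>\<^sub>M count_space UNIV" and P: "AE \<omega> in M. P (X \<omega>)"
  shows "\<exists>a. prob {\<omega> \<in> space M. X \<omega> = a} \<noteq> 0 \<and> P a"
proof (rule ccontr)
  assume neg: "\<not> ?thesis"
  have "AE \<omega> in M. \<forall>a\<in>{a. P a}. X \<omega> \<noteq> a"
  proof (subst AE_ball_countable)
    show "\<forall>a\<in>{a. P a}. AE \<omega> in M. X \<omega> \<noteq> a"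
      using neg by (auto simp: AE_iff_measurable[OF _ refl] emeasure_eq_measure)
  qed simp
  with P have "AE \<omega> in M. False" by eventually_elim auto
  then show False using AE_False by blast
qed

text \<open>Fixing \<open>b\<close> with \<open>P (Z = b) > 0\<close> in the symmetry relation shows that \<open>a P (Y = a) = c P (Z = a)\<close> for a
  constant \<open>c\<close>, which has to be the mean of \<open>Y\<close>. In particular \<open>Y\<close> has a finite mean, so that the
  denominator, which would be 0 for a non-integrable \<open>Y\<close>, is the intended one.\<close>

lemma (in prob_space) size_biased_mean:
  fixes Y Z :: "'a \<Rightarrow> nat"
  assumes meas [measurable]: "Y \<in> M \<rightarrow>\<^sub>M count_space UNIV" "Z \<in> M \<rightarrow>\<^sub>M count_space UNIV"
    and sym: "\<And>a b. real a * prob {\<omega> \<in> space M. Y \<omega> = a} * prob {\<omega> \<in> space M. Z \<omega> = b}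
      = real b * prob {\<omega> \<in> space M. Y \<omega> = b} * prob {\<omega> \<in> space M. Z \<omega> = a}"
    and pos: "AE \<omega> in M. 1 \<le> Y \<omega>"
  shows "expectation (\<lambda>\<omega>. (real (Y \<omega>))\<^sup>2) / expectation (\<lambda>\<omega>. real (Y \<omega>))
    = expectation (\<lambda>\<omega>. real (Z \<omega>))"
proof -
  define p q where "p a = prob {\<omega> \<in> space M. Y \<omega> = a}" and "q a = prob {\<omega> \<in> space M. Z \<omega> = a}" for a
  have nonneg: "0 \<le> p a" "0 \<le> q a" for a by (auto simp: p_def q_def)
  obtain b where b: "q b \<noteq> 0" using nat_valued_charges[OF meas(2), of "\<lambda>_. True"] by (auto simp: q_def)
  define c where "c = real b * p b / q b"
  have c: "real a * p a = c * q a" for a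
    using sym[of a b] b by (simp add: c_def p_def q_def field_simps)
  have "0 \<le> c" using nonneg by (simp add: c_def)
  have "c \<noteq> 0"
  proof
    assume "c = 0"
    moreover obtain a where "p a \<noteq> 0" "1 \<le> a" using nat_valued_charges[OF meas(1) pos] by (auto simp: p_def)
    ultimately show False using c[of a] by simp
  qed
  have key: "expectation (\<lambda>\<omega>. real (Y \<omega>) * g (Y \<omega>)) = c * expectation (\<lambda>\<omega>. g (Z \<omega>))"
    if g: "\<And>a. 0 \<le> g a" for g :: "nat \<Rightarrow> real"
  proof -
    have "(\<integral>\<^sup>+ \<omega>. ennreal (real (Y \<omega>) * g (Y \<omega>)) \<partial>M) = (\<Sum>a. ennreal (real a * g a) * ennreal (p a))"
      unfolding p_def by (rule nn_integral_nat_valued) simp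
    also have "\<dots> = (\<Sum>a. ennreal (c * g a) * ennreal (q a))"
    proof (intro arg_cong[where f=suminf] ext)
      fix a
      have "ennreal (real a * g a) * ennreal (p a) = ennreal (g a * (real a * p a))"
        using g nonneg by (simp add: ennreal_mult'[symmetric] mult_ac)
      also have "\<dots> = ennreal (c * g a) * ennreal (q a)"
        unfolding c using g nonneg \<open>0 \<le> c\<close> by (simp add: ennreal_mult'[symmetric] mult_ac)
      finally show "ennreal (real a * g a) * ennreal (p a) = ennreal (c * g a) * ennreal (q a)" .
    qed
    also have "\<dots> = (\<integral>\<^sup>+ \<omega>. ennreal (c * g (Z \<omega>)) \<partial>M)"
      unfolding q_def by (rule nn_integral_nat_valued[symmetric]) simp
    finally have "expectation (\<lambda>\<omega>. real (Y \<omega>) * g (Y \<omega>)) = expectation (\<lambda>\<omega>. c * g (Z \<omega>))"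
      using g \<open>0 \<le> c\<close> by (subst (1 2) integral_eq_nn_integral) simp_all
    then show ?thesis by simp
  qed
  have "expectation (\<lambda>\<omega>. real (Y \<omega>)) = c" using key[of "\<lambda>_. 1"] by (simp add: prob_space)
  moreover have "expectation (\<lambda>\<omega>. (real (Y \<omega>))\<^sup>2) = c * expectation (\<lambda>\<omega>. real (Z \<omega>))"
    using key[of real] by (simp add: power2_eq_square)
  ultimately show ?thesis using \<open>c \<noteq> 0\<close> by simp
qed

section \<open>Sums with predictable weights\<close>

lemma (in prob_space) indep_vars_prepend:
  fixes Y :: "'a \<Rightarrow> nat" and Z :: "nat \<Rightarrow> 'a \<Rightarrow> nat"
  assumes YZ: "indep_set (sets (vimage_algebra (space M) Y (count_space UNIV)))
      (sets (vimage_algebra (space M) (\<lambda>\<omega>. \<lambda>i\<in>{1..}. Z i \<omega>) (PiM {1..} (\<lambda>_. count_space UNIV))))"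
    and Z: "indep_vars (\<lambda>_. count_space UNIV) Z {1..}"
  shows "indep_vars (\<lambda>_. count_space UNIV) (\<lambda>i. if i = 0 then Y else Z i) UNIV"
proof -
  let ?X = "\<lambda>i. if i = 0 then Y else Z i"
  have Y: "Y -` A \<inter> space M \<in> sets (vimage_algebra (space M) Y (count_space UNIV))" for A
    by (rule in_vimage_algebra) simp
  have "Y \<in> M \<rightarrow>\<^sub>M count_space UNIV"
    using Y indep_setD_ev1[OF YZ] by (intro measurableI) auto
  moreover have Zm: "Z i \<in> M \<rightarrow>\<^sub>M count_space UNIV" if "i \<ge> 1" for i
    using Z that by (auto simp: indep_vars_def2)
  ultimately have meas: "?X i \<in> M \<rightarrow>\<^sub>M count_space UNIV" for i by auto
  have tail: "prob (\<Inter>j\<in>J. ?X j -` B j \<inter> space M) = (\<Prod>j\<in>J. prob (?X j -` B j \<inter> space M))"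
    if "finite J" "J \<noteq> {}" "0 \<notin> J" for J and B :: "nat \<Rightarrow> nat set"
  proof -
    have J: "J \<subseteq> {1..}" using that(3) by (auto simp: Suc_le_eq intro: gr0I)
    have "prob (\<Inter>j\<in>J. Z j -` B j \<inter> space M) = (\<Prod>j\<in>J. prob (Z j -` B j \<inter> space M))"
      using Z J that unfolding indep_vars_def2 by (intro indep_setsD[of _ "{1..}"]) auto
    moreover have "?X j = Z j" if "j \<in> J" for j using J that by auto
    ultimately show ?thesis by simp
  qed
  have "prob (\<Inter>j\<in>J. ?X j -` B j \<inter> space M) = (\<Prod>j\<in>J. prob (?X j -` B j \<inter> space M))"
    if J: "finite J" "J \<noteq> {}" for J and B :: "nat \<Rightarrow> nat set"
  proof (cases "0 \<in> J")
    case True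
    show ?thesis
    proof (cases "J = {0}")
      case False
      let ?J = "J - {0}"
      let ?E = "{f \<in> space (PiM {1..} (\<lambda>_. count_space UNIV)). \<forall>j\<in>?J. f j \<in> B j}"
      have "?E \<in> sets (PiM {1..} (\<lambda>_. count_space (UNIV :: nat set)))"
      proof -
        have "(\<lambda>f. f j) \<in> PiM {1..} (\<lambda>_. count_space (UNIV :: nat set)) \<rightarrow>\<^sub>M count_space UNIV"
          if "j \<in> ?J" for j
          by (rule measurable_component_singleton) (use that in auto)
        then show ?thesis using J True False
          by (intro sets.sets_Collect_finite_All') (auto intro!: pred_sets2 simp: pred_def[symmetric])
      qed
      then have E: "(\<lambda>\<omega>. \<lambda>i\<in>{1..}. Z i \<omega>) -` ?E \<inter> space M
          \<in> sets (vimage_algebra (space M) (\<lambda>\<omega>. \<lambda>i\<in>{1..}. Z i \<omega>) (PiM {1..} (\<lambda>_. count_space UNIV)))"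
        by (rule in_vimage_algebra)
      have eq: "(\<lambda>\<omega>. \<lambda>i\<in>{1..}. Z i \<omega>) -` ?E \<inter> space M = (\<Inter>j\<in>?J. ?X j -` B j \<inter> space M)"
        using False True by (auto simp: space_PiM)
      have "(\<Inter>j\<in>J. ?X j -` B j \<inter> space M) = (Y -` B 0 \<inter> space M) \<inter> (\<Inter>j\<in>?J. ?X j -` B j \<inter> space M)"
        using True False by (auto split: if_splits)
      then have "prob (\<Inter>j\<in>J. ?X j -` B j \<inter> space M) =
          prob (Y -` B 0 \<inter> space M) * prob (\<Inter>j\<in>?J. ?X j -` B j \<inter> space M)"
        using indep_setD[OF YZ Y E, of "B 0"] eq by simp
      also have "\<dots> = prob (Y -` B 0 \<inter> space M) * (\<Prod>j\<in>?J. prob (?X j -` B j \<inter> space M))"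
        using tail[of ?J B] J True False by auto
      also have "\<dots> = (\<Prod>j\<in>J. prob (?X j -` B j \<inter> space M))"
        using J(1) True by (simp add: prod.remove)
      finally show ?thesis .
    qed simp
  next
    case False
    then show ?thesis using tail[OF J] by simp
  qed
  then have prod: "\<forall>J\<subseteq>UNIV. J \<noteq> {} \<longrightarrow> finite J \<longrightarrow>
      (\<forall>B. prob (\<Inter>j\<in>J. ?X j -` B j \<inter> space M) = (\<Prod>j\<in>J. prob (?X j -` B j \<inter> space M)))"
    by blast
  show ?thesis unfolding indep_vars_def2
  proof (intro conjI indep_setsI ballI)
    show "?X i \<in> M \<rightarrow>\<^sub>M count_space UNIV" for i by (rule meas)
    show "{?X i -` A \<inter> space M |A. A \<in> sets (count_space UNIV)} \<subseteq> events" for i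
      using measurable_sets[OF meas[of i]] by blast
    fix A J assume J: "J \<noteq> {}" "J \<subseteq> UNIV" "finite J"
      and A: "\<forall>j\<in>J. A j \<in> {?X j -` A \<inter> space M |A. A \<in> sets (count_space UNIV)}"
    then have "\<forall>j\<in>J. \<exists>B. A j = ?X j -` B \<inter> space M" by blast
    then obtain B where "\<forall>j\<in>J. A j = ?X j -` B j \<inter> space M" by metis
    then show "prob (\<Inter>j\<in>J. A j) = (\<Prod>j\<in>J. prob (A j))"
      using prod J by simp
  qed
qed

text \<open>A function of the first \<open>n\<close> variables is independent of the next one. The function \<open>g\<close> is measurable
  because finitely many natural numbers range over a countable discrete space.\<close>

lemma (in prob_space) predictable_product:
  fixes X :: "nat \<Rightarrow> 'a \<Rightarrow> nat" and g :: "(nat \<Rightarrow> nat) \<Rightarrow> real" and h :: "nat \<Rightarrow> real"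
  assumes ind: "indep_vars (\<lambda>_. count_space UNIV) X UNIV"
    and dep: "\<And>f f'. (\<And>i. i < n \<Longrightarrow> f i = f' i) \<Longrightarrow> g f = g f'"
    and int: "integrable M (\<lambda>\<omega>. g (\<lambda>i. X i \<omega>))" "integrable M (\<lambda>\<omega>. h (X n \<omega>))"
  shows "integrable M (\<lambda>\<omega>. g (\<lambda>i. X i \<omega>) * h (X n \<omega>))"
    and "expectation (\<lambda>\<omega>. g (\<lambda>i. X i \<omega>) * h (X n \<omega>))
      = expectation (\<lambda>\<omega>. g (\<lambda>i. X i \<omega>)) * expectation (\<lambda>\<omega>. h (X n \<omega>))"
proof -
  have "indep_var (PiM {..<n} (\<lambda>_. count_space UNIV)) (\<lambda>\<omega>. restrict (\<lambda>i. X i \<omega>) {..<n})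
      (PiM {n} (\<lambda>_. count_space UNIV)) (\<lambda>\<omega>. restrict (\<lambda>i. X i \<omega>) {n})"
    by (rule indep_var_restrict[OF ind]) auto
  then have "indep_var borel (g \<circ> (\<lambda>\<omega>. restrict (\<lambda>i. X i \<omega>) {..<n}))
      borel ((\<lambda>f. h (f n)) \<circ> (\<lambda>\<omega>. restrict (\<lambda>i. X i \<omega>) {n}))"
    by (rule indep_var_compose) (simp_all add: count_space_PiM_finite)
  moreover have "g \<circ> (\<lambda>\<omega>. restrict (\<lambda>i. X i \<omega>) {..<n}) = (\<lambda>\<omega>. g (\<lambda>i. X i \<omega>))"
    by (auto simp: fun_eq_iff intro!: dep)
  moreover have "(\<lambda>f. h (f n)) \<circ> (\<lambda>\<omega>. restrict (\<lambda>i. X i \<omega>) {n}) = (\<lambda>\<omega>. h (X n \<omega>))"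
    by (auto simp: fun_eq_iff)
  ultimately have iv: "indep_var borel (\<lambda>\<omega>. g (\<lambda>i. X i \<omega>)) borel (\<lambda>\<omega>. h (X n \<omega>))" by simp
  from indep_var_integrable[OF iv int] indep_var_lebesgue_integral[OF iv int]
  show "integrable M (\<lambda>\<omega>. g (\<lambda>i. X i \<omega>) * h (X n \<omega>))"
    "expectation (\<lambda>\<omega>. g (\<lambda>i. X i \<omega>) * h (X n \<omega>))
      = expectation (\<lambda>\<omega>. g (\<lambda>i. X i \<omega>)) * expectation (\<lambda>\<omega>. h (X n \<omega>))"
    by auto
qed

lemma (in prob_space) measurable_predictable:
  fixes X :: "nat \<Rightarrow> 'a \<Rightarrow> nat" and g :: "(nat \<Rightarrow> nat) \<Rightarrow> real"
  assumes [measurable]: "\<And>i. X i \<in> M \<rightarrow>\<^sub>M count_space UNIV"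
    and dep: "\<And>f f'. (\<And>i. i < n \<Longrightarrow> f i = f' i) \<Longrightarrow> g f = g f'"
  shows "(\<lambda>\<omega>. g (\<lambda>i. X i \<omega>)) \<in> borel_measurable M"
proof -
  have "(\<lambda>\<omega>. restrict (\<lambda>i. X i \<omega>) {..<n}) \<in> M \<rightarrow>\<^sub>M PiM {..<n} (\<lambda>_. count_space UNIV)"
    by measurable
  moreover have "g \<in> PiM {..<n} (\<lambda>_. count_space UNIV) \<rightarrow>\<^sub>M borel"
    by (simp add: count_space_PiM_finite)
  ultimately have "(\<lambda>\<omega>. g (restrict (\<lambda>i. X i \<omega>) {..<n})) \<in> borel_measurable M"
    by (rule measurable_compose)
  moreover have "g (restrict (\<lambda>i. X i \<omega>) {..<n}) = g (\<lambda>i. X i \<omega>)" for \<omega>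
    by (rule dep) simp
  ultimately show ?thesis by simp
qed

text \<open>The weight at \<open>j\<close> is known before \<open>X j\<close> is revealed, so the increments of the sum are orthogonal.
  The sum starts at 1 because the variable at 0, which stands for the degree of the root, need not have
  the same mean and variance as the others.\<close>

lemma (in prob_space) predictable_sum_second_moment:
  fixes X :: "nat \<Rightarrow> 'a \<Rightarrow> nat" and w :: "(nat \<Rightarrow> nat) \<Rightarrow> nat \<Rightarrow> real"
  assumes ind: "indep_vars (\<lambda>_. count_space UNIV) X UNIV"
    and sq: "\<And>j. 1 \<le> j \<Longrightarrow> integrable M (\<lambda>\<omega>. (real (X j \<omega>))\<^sup>2)"
    and mean: "\<And>j. 1 \<le> j \<Longrightarrow> expectation (\<lambda>\<omega>. real (X j \<omega>)) = q"
    and var: "\<And>j. 1 \<le> j \<Longrightarrow> expectation (\<lambda>\<omega>. (real (X j \<omega>) - q)\<^sup>2) = s"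
    and dep: "\<And>f f' j. (\<And>i. i < j \<Longrightarrow> f i = f' i) \<Longrightarrow> w f j = w f' j"
    and bnd: "\<And>f j. \<bar>w f j\<bar> \<le> 1"
  shows "integrable M (\<lambda>\<omega>. (\<Sum>j=1..<N. w (\<lambda>i. X i \<omega>) j * (real (X j \<omega>) - q))\<^sup>2)" (is "?I N")
    and "expectation (\<lambda>\<omega>. (\<Sum>j=1..<N. w (\<lambda>i. X i \<omega>) j * (real (X j \<omega>) - q))\<^sup>2)
      = s * expectation (\<lambda>\<omega>. \<Sum>j=1..<N. (w (\<lambda>i. X i \<omega>) j)\<^sup>2)" (is "?E N")
proof -
  have X [measurable]: "X i \<in> M \<rightarrow>\<^sub>M count_space UNIV" for i
    using ind by (auto simp: indep_vars_def2)
  have w [measurable]: "(\<lambda>\<omega>. w (\<lambda>i. X i \<omega>) j) \<in> borel_measurable M" for j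
    by (rule measurable_predictable[of X j "\<lambda>f. w f j", OF X dep])
  have bnd2: "(w f j)\<^sup>2 \<le> 1" for f j using bnd[of f j] by (simp add: abs_square_le_1)
  have iX: "integrable M (\<lambda>\<omega>. real (X j \<omega>))" if "1 \<le> j" for j
    using square_integrable_imp_integrable[OF _ sq[OF that]] by simp
  have iw: "integrable M (\<lambda>\<omega>. (w (\<lambda>i. X i \<omega>) j)\<^sup>2)" for j
    by (rule integrable_const_bound[of _ 1]) (use bnd2 in auto)
  have ic: "integrable M (\<lambda>\<omega>. (real (X j \<omega>) - q)\<^sup>2)" if "1 \<le> j" for j
  proof -
    have "(\<lambda>\<omega>. (real (X j \<omega>) - q)\<^sup>2) = (\<lambda>\<omega>. (real (X j \<omega>))\<^sup>2 - 2 * q * real (X j \<omega>) + q\<^sup>2)"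
      by (simp add: power2_diff fun_eq_iff mult_ac)
    then show ?thesis using sq[OF that] iX[OF that] by simp
  qed
  \<comment> \<open>\<open>S N\<close> is a function of the first \<open>N\<close> variables alone, so the cross term in the expansion of
    \<open>(S (Suc N))\<^sup>2\<close> has expectation 0.\<close>
  define S where "S N f = (\<Sum>j=1..<N. w f j * (real (f j) - q))" for N f
  have Sdep: "S N f = S N f'" if "\<And>i. i < N \<Longrightarrow> f i = f' i" for N f f'
    unfolding S_def
  proof (intro sum.cong refl)
    fix j assume "j \<in> {1..<N}"
    then have "w f j = w f' j" "f j = f' j" using that by (auto intro: dep)
    then show "w f j * (real (f j) - q) = w f' j * (real (f' j) - q)" by simp
  qed
  have "?I N \<and> ?E N"
  proof (induction N)
    case 0 then show ?case by simp
  next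
    case (Suc N)
    show ?case
    proof (cases "N = 0")
      case False
      then have N: "1 \<le> N" by simp
      let ?S = "\<lambda>\<omega>. S N (\<lambda>i. X i \<omega>)" and ?w = "\<lambda>\<omega>. w (\<lambda>i. X i \<omega>) N" and ?Y = "\<lambda>\<omega>. real (X N \<omega>) - q"
      have iS: "integrable M ?S" unfolding S_def
      proof (intro Bochner_Integration.integrable_sum)
        fix j assume "j \<in> {1..<N}"
        then have "integrable M (\<lambda>\<omega>. real (X j \<omega>) - q)" using iX by simp
        then show "integrable M (\<lambda>\<omega>. w (\<lambda>i. X i \<omega>) j * (real (X j \<omega>) - q))"
        proof (rule Bochner_Integration.integrable_bound)
          show "AE \<omega> in M. norm (w (\<lambda>i. X i \<omega>) j * (real (X j \<omega>) - q)) \<le> norm (real (X j \<omega>) - q)"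
            using bnd by (auto simp: abs_mult intro!: mult_left_le_one_le)
        qed simp
      qed
      have iSw: "integrable M (\<lambda>\<omega>. ?S \<omega> * ?w \<omega>)"
      proof (rule Bochner_Integration.integrable_bound[OF iS])
        show "AE \<omega> in M. norm (?S \<omega> * ?w \<omega>) \<le> norm (?S \<omega>)"
          using bnd by (auto simp: abs_mult intro!: mult_right_le_one_le)
      qed (simp add: S_def)
      have iY: "integrable M ?Y" and EY: "expectation ?Y = 0"
        using iX[OF N] mean[OF N] by (auto simp: prob_space)
      have dep1: "S N f * w f N = S N f' * w f' N" "(w f N)\<^sup>2 = (w f' N)\<^sup>2"
        if "\<And>i. i < N \<Longrightarrow> f i = f' i" for f f'
        using Sdep[of N f f'] dep[of N f f'] that by auto
      have cross: "integrable M (\<lambda>\<omega>. ?S \<omega> * ?w \<omega> * ?Y \<omega>)" "expectation (\<lambda>\<omega>. ?S \<omega> * ?w \<omega> * ?Y \<omega>) = 0"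
        using predictable_product[OF ind, of N "\<lambda>f. S N f * w f N" "\<lambda>x. real x - q", OF dep1(1) iSw iY] EY
        by auto
      have sqr: "integrable M (\<lambda>\<omega>. (?w \<omega>)\<^sup>2 * (?Y \<omega>)\<^sup>2)"
        "expectation (\<lambda>\<omega>. (?w \<omega>)\<^sup>2 * (?Y \<omega>)\<^sup>2) = expectation (\<lambda>\<omega>. (?w \<omega>)\<^sup>2) * s"
        using predictable_product[OF ind, of N "\<lambda>f. (w f N)\<^sup>2" "\<lambda>x. (real x - q)\<^sup>2", OF dep1(2) iw ic[OF N]]
          var[OF N] by auto
      have exp: "(S (Suc N) (\<lambda>i. X i \<omega>))\<^sup>2 = (?S \<omega>)\<^sup>2 + 2 * (?S \<omega> * ?w \<omega> * ?Y \<omega>) + (?w \<omega>)\<^sup>2 * (?Y \<omega>)\<^sup>2" for \<omega>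
      proof -
        have "S (Suc N) (\<lambda>i. X i \<omega>) = ?S \<omega> + ?w \<omega> * ?Y \<omega>" using N by (simp add: S_def)
        then show ?thesis by (simp add: power2_sum power_mult_distrib)
      qed
      have IH: "integrable M (\<lambda>\<omega>. (?S \<omega>)\<^sup>2)"
        "expectation (\<lambda>\<omega>. (?S \<omega>)\<^sup>2) = s * expectation (\<lambda>\<omega>. \<Sum>j=1..<N. (w (\<lambda>i. X i \<omega>) j)\<^sup>2)"
        using Suc unfolding S_def by auto
      have "integrable M (\<lambda>\<omega>. (S (Suc N) (\<lambda>i. X i \<omega>))\<^sup>2)"
        unfolding exp using IH(1) cross(1) sqr(1) by simp
      moreover have "expectation (\<lambda>\<omega>. (S (Suc N) (\<lambda>i. X i \<omega>))\<^sup>2)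
          = s * expectation (\<lambda>\<omega>. \<Sum>j=1..<Suc N. (w (\<lambda>i. X i \<omega>) j)\<^sup>2)"
      proof -
        have "expectation (\<lambda>\<omega>. (S (Suc N) (\<lambda>i. X i \<omega>))\<^sup>2) =
            expectation (\<lambda>\<omega>. (?S \<omega>)\<^sup>2) + 2 * expectation (\<lambda>\<omega>. ?S \<omega> * ?w \<omega> * ?Y \<omega>)
              + expectation (\<lambda>\<omega>. (?w \<omega>)\<^sup>2 * (?Y \<omega>)\<^sup>2)"
          unfolding exp using IH(1) cross(1) sqr(1) by simp
        also have "\<dots> = s * (expectation (\<lambda>\<omega>. \<Sum>j=1..<N. (w (\<lambda>i. X i \<omega>) j)\<^sup>2)
            + expectation (\<lambda>\<omega>. (?w \<omega>)\<^sup>2))"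
          unfolding IH(2) cross(2) sqr(2) by (simp add: distrib_left)
        also have "\<dots> = s * expectation (\<lambda>\<omega>. \<Sum>j=1..<Suc N. (w (\<lambda>i. X i \<omega>) j)\<^sup>2)"
          using iw N by simp
        finally show ?thesis .
      qed
      ultimately show ?thesis unfolding S_def by simp
    qed simp
  qed
  then show "?I N" "?E N" by auto
qed

section \<open>The non-backtracking walk on a breadth-first labelled tree\<close>

text \<open>The probability that the non-backtracking walk is at \<open>j\<close> after \<open>k\<close> steps, written in terms of the
  offspring numbers \<open>f\<close>. The sum has at most one nonzero term, that of the parent of \<open>j\<close>; this form
  makes it evident that only the values of \<open>f\<close> below \<open>j\<close> matter.\<close>

fun explore_weight :: "(nat \<Rightarrow> nat) \<Rightarrow> nat \<Rightarrow> nat \<Rightarrow> real" where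
  "explore_weight f 0 j = of_bool (j = 0)"
| "explore_weight f (Suc k) j =
    (\<Sum>v<j. of_bool (first_label f v < j \<and> j \<le> first_label f (Suc v)) * (explore_weight f k v / real (f v)))"

lemma explore_weight_cong:
  "(\<And>i. i < j \<Longrightarrow> f i = f' i) \<Longrightarrow> explore_weight f k j = explore_weight f' k j"
proof (induction k arbitrary: j)
  case (Suc k)
  have fl: "first_label f v = first_label f' v" if "v \<le> j" for v
    unfolding first_label_def by (rule sum.cong) (use Suc.prems that in auto)
  have "explore_weight f k v = explore_weight f' k v" if "v < j" for v
    using Suc that by simp
  then show ?case unfolding explore_weight.simps
    by (intro sum.cong refl) (simp add: fl Suc.prems)
qed simp

lemma sum_over_parents_le:
  assumes "\<And>v. v < j \<Longrightarrow> first_label f v < j \<Longrightarrow> j \<le> first_label f (Suc v) \<Longrightarrow> c v \<le> C" "0 \<le> C"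
  shows "(\<Sum>v<j. of_bool (first_label f v < j \<and> j \<le> first_label f (Suc v)) * c v) \<le> (C :: real)"
proof -
  let ?P = "\<lambda>v. first_label f v < j \<and> j \<le> first_label f (Suc v)"
  have mono: "first_label f v \<le> first_label f v'" if "v \<le> v'" for v v'
    unfolding first_label_def by (rule sum_mono2) (use that in auto)
  have uniq: "v = v'" if "?P v" "?P v'" for v v'
  proof (rule ccontr)
    assume "v \<noteq> v'"
    then consider "Suc v \<le> v'" | "Suc v' \<le> v" by linarith
    then show False using that mono[of "Suc v" v'] mono[of "Suc v'" v] by cases auto
  qed
  show ?thesis
  proof (cases "\<exists>v<j. ?P v")
    case True
    then obtain v where v: "v < j" "?P v" by blast
    have "(\<Sum>u<j. of_bool (?P u) * c u) = (\<Sum>u\<in>{v}. of_bool (?P u) * c u)"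
      by (rule sum.mono_neutral_right) (use v uniq in auto)
    then show ?thesis using v assms(1) by simp
  next
    case False
    then have "(\<Sum>u<j. of_bool (?P u) * c u) = 0" by (intro sum.neutral) auto
    then show ?thesis using assms(2) by simp
  qed
qed

lemma explore_weight_bounds: "0 \<le> explore_weight f k j \<and> explore_weight f k j \<le> 1"
proof (induction k arbitrary: j)
  case (Suc k)
  have "explore_weight f k v / real (f v) \<le> 1" for v
    using Suc[of v] by (cases "f v = 0") (auto simp: divide_le_eq intro: order_trans)
  then show ?case using Suc
    unfolding explore_weight.simps by (intro conjI sum_nonneg sum_over_parents_le) auto
qed simp

lemma explore_weight_root: "explore_weight f (Suc k) 0 = 0"
  by simp

text \<open>The bound is \<open>1 / 2 ^ k\<close> after \<open>k + 1\<close> steps, because the root may have a single child: the bound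
  halves with every step except the first one. A later step never starts at the root, which has weight 0
  by then.\<close>

lemma explore_weight_decay:
  assumes "\<And>v. 1 \<le> v \<Longrightarrow> 2 \<le> f v"
  shows "explore_weight f (Suc k) j \<le> 1 / 2 ^ k"
proof (induction k arbitrary: j)
  case 0
  then show ?case using explore_weight_bounds[of f "Suc 0" j] by (simp del: explore_weight.simps)
next
  case (Suc k)
  have "explore_weight f (Suc k) v / real (f v) \<le> 1 / 2 ^ Suc k" for v
  proof (cases "v = 0")
    case False
    then have f: "2 \<le> f v" using assms by simp
    have "explore_weight f (Suc k) v / real (f v) \<le> explore_weight f (Suc k) v / 2"
      using f explore_weight_bounds[of f "Suc k" v] by (intro divide_left_mono) auto
    also have "\<dots> \<le> (1 / 2 ^ k) / 2" using Suc by (intro divide_right_mono) auto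
    finally show ?thesis by simp
  qed simp
  then show ?case unfolding explore_weight.simps(2)[of f "Suc k"]
    by (intro sum_over_parents_le) auto
qed

lemma pmf_walk_law_regular:
  assumes T: "regular_bfs_tree T"
  shows "pmf (walk_law (offspring T) 0 k) j = explore_weight (noff T) k j"
proof (induction k arbitrary: j)
  case (Suc k)
  note fin = regular_finite_offspring[OF T] and ne = regular_offspring_nonempty[OF T]
  have less: "v < j" if "j \<in> offspring T v" for v
    using T that by (auto simp: regular_bfs_tree_def bfs_labelled_def)
  have "pmf (walk_law (offspring T) 0 (Suc k)) j =
      (\<integral>v. indicator (offspring T v) j / real (noff T v) \<partial>measure_pmf (walk_law (offspring T) 0 k))"
  proof -
    have "(\<lambda>v. if finite (offspring T v) \<and> offspring T v \<noteq> {} then pmf_of_set (offspring T v) else return_pmf v)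
        = (\<lambda>v. pmf_of_set (offspring T v))"
      using fin ne by (intro ext) simp
    then show ?thesis unfolding walk_law.simps pmf_bind noff_def using fin ne by simp
  qed
  also have "\<dots> = (\<Sum>v<j. indicator (offspring T v) j / real (noff T v) * pmf (walk_law (offspring T) 0 k) v)"
    by (rule integral_measure_pmf_real) (use less in \<open>auto split: split_indicator_asm\<close>)
  also have "\<dots> = explore_weight (noff T) (Suc k) j"
    unfolding explore_weight.simps Suc regular_offspring[OF T]
    by (intro sum.cong refl) (auto simp: indicator_def)
  finally show ?case .
qed (auto simp: indicator_def)

lemma explore_weight_sum_le:
  assumes "regular_bfs_tree T" "finite A"
  shows "(\<Sum>j\<in>A. explore_weight (noff T) k j) \<le> 1"
proof -
  have "(\<Sum>j\<in>A. explore_weight (noff T) k j) = measure_pmf.prob (walk_law (offspring T) 0 k) A"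
    using assms by (simp add: measure_measure_pmf_finite pmf_walk_law_regular)
  then show ?thesis by simp
qed

text \<open>From the first step on the walk sits at a vertex of degree one more than its offspring number, and
  the weights sum to 1. Only finitely many vertices carry weight, so the partial sums over labels are
  eventually constant.\<close>

lemma nonbacktracking_bias_centred:
  assumes T: "regular_bfs_tree T"
  shows "\<forall>\<^sub>F N in sequentially.
    (\<Sum>j=1..<N. explore_weight (noff T) (Suc k) j * (real (noff T j) - q))
      = nonbacktracking_bias (Suc k) T - (q + 1 - real (deg T (vroot T)))"
proof -
  let ?p = "walk_law (offspring T) 0 (Suc k)" and ?w = "explore_weight (noff T) (Suc k)"
  have Tr: "T \<in> rgraphs" using T by (simp add: regular_bfs_tree_def)
  have pw: "pmf ?p j = ?w j" for j by (rule pmf_walk_law_regular[OF T])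
  obtain B where B: "\<And>j. j \<in> set_pmf ?p \<Longrightarrow> j < B"
    using finite_set_walk_law[of "offspring T" 0 "Suc k"] by (auto simp: finite_nat_set_iff_bounded)
  have "(\<Sum>j=1..<N. ?w j * (real (noff T j) - q))
      = nonbacktracking_bias (Suc k) T - (q + 1 - real (deg T (vroot T)))" if N: "B \<le> N" for N
  proof -
    have sub: "set_pmf ?p \<subseteq> {1..<N}"
    proof
      fix j assume j: "j \<in> set_pmf ?p"
      then have "pmf ?p j \<noteq> 0" unfolding set_pmf_iff .
      then have "j \<noteq> 0" unfolding pw using explore_weight_root by metis
      then show "j \<in> {1..<N}" using B[OF j] N by simp
    qed
    have extend: "(\<Sum>j\<in>set_pmf ?p. pmf ?p j * c j) = (\<Sum>j=1..<N. ?w j * c j)" for c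
      unfolding pw[symmetric] by (rule sum.mono_neutral_left) (use sub in \<open>auto simp: set_pmf_iff simp del: walk_law.simps\<close>)
    have one: "(\<Sum>j=1..<N. ?w j) = 1"
      using extend[of "\<lambda>_. 1"] sum_pmf_eq_1[OF finite_set_walk_law order_refl, of "offspring T" 0 "Suc k"]
      by simp
    have "nonbacktracking_bias (Suc k) T + real (deg T (vroot T)) = (\<Sum>j=1..<N. ?w j * real (deg T j))"
      unfolding nonbacktracking_bias_def bias_eq_suminf(2)[OF Tr] regular_root[OF T] extend by simp
    also have "\<dots> = (\<Sum>j=1..<N. ?w j * (real (noff T j) - q) + (q + 1) * ?w j)"
      by (intro sum.cong refl) (simp add: regular_deg[OF T] algebra_simps)
    also have "\<dots> = (\<Sum>j=1..<N. ?w j * (real (noff T j) - q)) + (q + 1)"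
      unfolding sum.distrib sum_distrib_left[symmetric] one by simp
    finally show ?thesis by simp
  qed
  then show ?thesis unfolding eventually_sequentially by blast
qed

text \<open>The number of vertices in generation \<open>k + 1\<close> is random and may be unbounded, so the second moment is
  computed for the sum over the labels below \<open>N\<close> and passed on to the limit by Fatou's lemma. The sum of
  squared weights is at most the largest weight times the sum of the weights.\<close>

lemma nonbacktracking_bias_second_moment:
  assumes L: "prob_space L"
    and reg: "AE T in L. regular_bfs_tree T"
    and ind: "prob_space.indep_vars L (\<lambda>_. count_space UNIV) (\<lambda>i. if i = 0 then (\<lambda>T. deg T (vroot T)) else (\<lambda>T. noff T i)) UNIV"
    and sq: "\<And>j. 1 \<le> j \<Longrightarrow> integrable L (\<lambda>T. (real (noff T j))\<^sup>2)"
    and mean: "\<And>j. 1 \<le> j \<Longrightarrow> (\<integral>T. real (noff T j) \<partial>L) = q"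
    and var: "\<And>j. 1 \<le> j \<Longrightarrow> (\<integral>T. (real (noff T j) - q)\<^sup>2 \<partial>L) = s"
    and two: "AE T in L. \<forall>v\<ge>1. 2 \<le> noff T v"
  shows "(\<integral>\<^sup>+T. ennreal ((nonbacktracking_bias (Suc k) T - (q + 1 - real (deg T (vroot T))))\<^sup>2) \<partial>L)
    \<le> ennreal (s / 2 ^ k)"
proof -
  interpret prob_space L by fact
  let ?X = "\<lambda>i. if i = 0 then (\<lambda>T. deg T (vroot T)) else (\<lambda>T. noff T i)"
  let ?w = "\<lambda>f. explore_weight f (Suc k)"
  define S where "S N T = (\<Sum>j=1..<N. ?w (\<lambda>i. ?X i T) j * (real (?X j T) - q))" for N T
  have s: "0 \<le> s" unfolding var[OF order_refl, symmetric] by (rule integral_nonneg_AE) simp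
  have Xnoff: "AE T in L. regular_bfs_tree T \<and> (\<lambda>i. ?X i T) = noff T"
    using reg
  proof eventually_elim
    case (elim T)
    then show ?case using regular_deg_root[OF elim] regular_root[OF elim] by (auto simp: fun_eq_iff)
  qed
  have X: "?X i \<in> L \<rightarrow>\<^sub>M count_space UNIV" for i
    by (rule bspec[OF conjunct1[OF ind[unfolded indep_vars_def2]]]) simp
  have w [measurable]: "(\<lambda>T. ?w (\<lambda>i. ?X i T) j) \<in> borel_measurable L" for j
    by (rule measurable_predictable[of ?X j "\<lambda>f. ?w f j", OF X]) (rule explore_weight_cong)
  have moment: "integrable L (\<lambda>T. (S N T)\<^sup>2)"
      "expectation (\<lambda>T. (S N T)\<^sup>2) = s * expectation (\<lambda>T. \<Sum>j=1..<N. (?w (\<lambda>i. ?X i T) j)\<^sup>2)" for N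
  proof -
    have bnd: "\<bar>?w f j\<bar> \<le> 1" for f j
      using explore_weight_bounds[of f "Suc k" j] by (simp del: explore_weight.simps)
    have c: "explore_weight f (Suc k) j = explore_weight f' (Suc k) j" if "\<And>i. i < j \<Longrightarrow> f i = f' i" for f f' j
      using that by (rule explore_weight_cong)
    have nz: "?X j = (\<lambda>T. noff T j)" if "1 \<le> j" for j using that by simp
    have sq': "integrable L (\<lambda>T. (real (?X j T))\<^sup>2)" if "1 \<le> j" for j
      unfolding nz[OF that] by (rule sq[OF that])
    have mean': "expectation (\<lambda>T. real (?X j T)) = q" if "1 \<le> j" for j
      unfolding nz[OF that] by (rule mean[OF that])
    have var': "expectation (\<lambda>T. (real (?X j T) - q)\<^sup>2) = s" if "1 \<le> j" for j
      unfolding nz[OF that] by (rule var[OF that])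
    note m = predictable_sum_second_moment[where X="?X" and w="?w" and q=q and s=s, OF ind sq' mean' var' c bnd]
    show "integrable L (\<lambda>T. (S N T)\<^sup>2)"
      unfolding S_def by (rule m(1))
    show "expectation (\<lambda>T. (S N T)\<^sup>2) = s * expectation (\<lambda>T. \<Sum>j=1..<N. (?w (\<lambda>i. ?X i T) j)\<^sup>2)"
      unfolding S_def by (rule m(2))
  qed
  have bound: "(\<integral>\<^sup>+T. ennreal ((S N T)\<^sup>2) \<partial>L) \<le> ennreal (s / 2 ^ k)" for N
  proof -
    have "expectation (\<lambda>T. \<Sum>j=1..<N. (?w (\<lambda>i. ?X i T) j)\<^sup>2) \<le> expectation (\<lambda>T. 1 / 2 ^ k)"
    proof (rule integral_mono_AE)
      have "(?w f j)\<^sup>2 \<le> 1" for f j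
        using explore_weight_bounds[of f "Suc k" j] by (simp add: abs_square_le_1 del: explore_weight.simps)
      then show "integrable L (\<lambda>T. \<Sum>j=1..<N. (?w (\<lambda>i. ?X i T) j)\<^sup>2)"
        by (intro Bochner_Integration.integrable_sum integrable_const_bound[of _ 1]) (auto simp del: explore_weight.simps)
      show "AE T in L. (\<Sum>j=1..<N. (?w (\<lambda>i. ?X i T) j)\<^sup>2) \<le> 1 / 2 ^ k"
        using Xnoff two
      proof eventually_elim
        case (elim T)
        then have T: "regular_bfs_tree T" and X: "(\<lambda>i. ?X i T) = noff T" by auto
        have "(\<Sum>j=1..<N. (?w (noff T) j)\<^sup>2) \<le> (\<Sum>j=1..<N. 1 / 2 ^ k * ?w (noff T) j)"
          unfolding power2_eq_square
          using explore_weight_bounds explore_weight_decay[of "noff T" k] elim(2)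
          by (intro sum_mono mult_right_mono) (auto simp del: explore_weight.simps)
        also have "\<dots> \<le> 1 / 2 ^ k * 1"
          unfolding sum_distrib_left[symmetric] by (intro mult_left_mono explore_weight_sum_le[OF T]) auto
        finally show ?case unfolding X by simp
      qed
    qed simp
    then have "expectation (\<lambda>T. \<Sum>j=1..<N. (?w (\<lambda>i. ?X i T) j)\<^sup>2) \<le> 1 / 2 ^ k" by (simp add: prob_space)
    then have "expectation (\<lambda>T. (S N T)\<^sup>2) \<le> s / 2 ^ k"
      unfolding moment(2) using s mult_left_mono[of _ "1 / 2 ^ k" s] by simp
    then show ?thesis by (simp add: nn_integral_eq_integral[OF moment(1)] ennreal_leI)
  qed
  have "(\<integral>\<^sup>+T. ennreal ((nonbacktracking_bias (Suc k) T - (q + 1 - real (deg T (vroot T))))\<^sup>2) \<partial>L)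
      = (\<integral>\<^sup>+T. liminf (\<lambda>N. ennreal ((S N T)\<^sup>2)) \<partial>L)"
  proof (rule nn_integral_cong_AE)
    show "AE T in L. ennreal ((nonbacktracking_bias (Suc k) T - (q + 1 - real (deg T (vroot T))))\<^sup>2)
        = liminf (\<lambda>N. ennreal ((S N T)\<^sup>2))"
      using Xnoff
    proof eventually_elim
      case (elim T)
      then have T: "regular_bfs_tree T" and X: "\<And>i. ?X i T = noff T i" by (auto simp: fun_eq_iff)
      have "\<forall>\<^sub>F N in sequentially. ennreal ((S N T)\<^sup>2) =
          ennreal ((nonbacktracking_bias (Suc k) T - (q + 1 - real (deg T (vroot T))))\<^sup>2)"
        using nonbacktracking_bias_centred[OF T, of k q] unfolding S_def X
        by eventually_elim simp
      then have "(\<lambda>N. ennreal ((S N T)\<^sup>2)) \<longlonglongrightarrow>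
          ennreal ((nonbacktracking_bias (Suc k) T - (q + 1 - real (deg T (vroot T))))\<^sup>2)"
        by (rule tendsto_eventually)
      then show ?case using lim_imp_Liminf[OF sequentially_bot] by metis
    qed
  qed
  also have "\<dots> \<le> liminf (\<lambda>N. \<integral>\<^sup>+T. ennreal ((S N T)\<^sup>2) \<partial>L)"
  proof (rule nn_integral_liminf)
    have "S N \<in> borel_measurable L" for N
      unfolding S_def
      by (intro borel_measurable_sum borel_measurable_times borel_measurable_diff borel_measurable_const
          w measurable_compose[OF X]) simp
    then show "(\<lambda>T. ennreal ((S N T)\<^sup>2)) \<in> borel_measurable L" for N by measurable
  qed
  also have "\<dots> \<le> ennreal (s / 2 ^ k)"
    by (rule order_trans[OF Liminf_mono[of _ "\<lambda>_. ennreal (s / 2 ^ k)"]]) (use bound in \<open>auto simp: Liminf_const\<close>)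
  finally show ?thesis .
qed

lemma conv_in_prob_if_second_moment:
  assumes L: "prob_space L" and [measurable]: "\<And>k. Y k \<in> borel_measurable L" "Z \<in> borel_measurable L"
    and le: "\<And>k. (\<integral>\<^sup>+x. ennreal ((Y (Suc k) x - Z x)\<^sup>2) \<partial>L) \<le> ennreal (b k)" and b: "b \<longlonglongrightarrow> 0" "\<And>k. 0 \<le> b k"
  shows "conv_in_prob L Y Z"
  unfolding conv_in_prob_def
proof (intro allI impI)
  interpret prob_space L by fact
  fix \<epsilon> :: real assume \<epsilon>: "0 < \<epsilon>"
  have le': "prob {x \<in> space L. \<epsilon> < \<bar>Y (Suc k) x - Z x\<bar>} \<le> b k / \<epsilon>\<^sup>2" for k
  proof -
    have "emeasure L {x \<in> space L. \<epsilon> < \<bar>Y (Suc k) x - Z x\<bar>}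
        \<le> emeasure L {x \<in> space L. 1 \<le> ennreal (1 / \<epsilon>\<^sup>2) * ennreal ((Y (Suc k) x - Z x)\<^sup>2)}"
    proof (rule emeasure_mono)
      show "{x \<in> space L. \<epsilon> < \<bar>Y (Suc k) x - Z x\<bar>}
          \<subseteq> {x \<in> space L. 1 \<le> ennreal (1 / \<epsilon>\<^sup>2) * ennreal ((Y (Suc k) x - Z x)\<^sup>2)}"
      proof safe
        fix x assume "\<epsilon> < \<bar>Y (Suc k) x - Z x\<bar>"
        then have "\<epsilon>\<^sup>2 \<le> (Y (Suc k) x - Z x)\<^sup>2" using \<epsilon> by (simp add: abs_le_square_iff[symmetric])
        then have "1 \<le> 1 / \<epsilon>\<^sup>2 * (Y (Suc k) x - Z x)\<^sup>2" using \<epsilon> by (simp add: field_simps)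
        then have "ennreal 1 \<le> ennreal (1 / \<epsilon>\<^sup>2 * (Y (Suc k) x - Z x)\<^sup>2)" by (rule ennreal_leI)
        then show "1 \<le> ennreal (1 / \<epsilon>\<^sup>2) * ennreal ((Y (Suc k) x - Z x)\<^sup>2)"
          unfolding ennreal_1 by (subst ennreal_mult'[symmetric]) auto
      qed
    qed measurable
    also have "\<dots> \<le> ennreal (1 / \<epsilon>\<^sup>2) * (\<integral>\<^sup>+x. ennreal ((Y (Suc k) x - Z x)\<^sup>2) * indicator (space L) x \<partial>L)"
      by (rule nn_integral_Markov_inequality) measurable
    also have "\<dots> \<le> ennreal (1 / \<epsilon>\<^sup>2) * ennreal (b k)"
      using le[of k] by (intro mult_left_mono) (auto cong: nn_integral_cong)
    also have "\<dots> = ennreal (b k / \<epsilon>\<^sup>2)" using b(2) by (simp add: ennreal_mult'[symmetric])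
    finally show ?thesis using b(2)[of k] by (simp add: emeasure_eq_measure)
  qed
  have "(\<lambda>k. b k / \<epsilon>\<^sup>2) \<longlonglongrightarrow> 0" using tendsto_divide[OF b(1) tendsto_const[of "\<epsilon>\<^sup>2"]] \<epsilon> by simp
  then have "(\<lambda>k. prob {x \<in> space L. \<epsilon> < \<bar>Y (Suc k) x - Z x\<bar>}) \<longlonglongrightarrow> 0"
    by (rule tendsto_sandwich[OF _ _ tendsto_const, rotated 2]) (use le' in simp_all)
  then show "(\<lambda>k. prob {x \<in> space L. \<epsilon> < \<bar>Y k x - Z x\<bar>}) \<longlonglongrightarrow> 0"
    by (rule LIMSEQ_imp_Suc)
qed

section \<open>The walk on a finite connected non-bipartite graph\<close>

text \<open>The expectation of \<open>g\<close> after \<open>k\<close> steps of the walk started at \<open>v\<close>. Unlike \<open>walk_law\<close>, it is defined by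
  conditioning on the first step, so that contraction estimates can be run over all starting
  points at once.\<close>

fun walk_average :: "(nat \<Rightarrow> nat set) \<Rightarrow> (nat \<Rightarrow> real) \<Rightarrow> nat \<Rightarrow> nat \<Rightarrow> real" where
  "walk_average S g 0 v = g v"
| "walk_average S g (Suc k) v = (\<Sum>u\<in>S v. walk_average S g k u) / real (card (S v))"

lemma expectation_walk_law:
  assumes "\<And>v. v \<in> V \<Longrightarrow> finite (S v) \<and> S v \<noteq> {} \<and> S v \<subseteq> V" "r \<in> V" "finite V"
  shows "set_pmf (walk_law S r k) \<subseteq> V"
    and "measure_pmf.expectation (walk_law S r k) (walk_average S g l) = walk_average S g (k + l) r"
proof -
  show V: "set_pmf (walk_law S r k) \<subseteq> V" for k
    by (induction k) (use assms in \<open>auto simp: set_pmf_of_set split: if_splits\<close>, blast+)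
  show "measure_pmf.expectation (walk_law S r k) (walk_average S g l) = walk_average S g (k + l) r"
  proof (induction k arbitrary: l)
    case (Suc k)
    let ?K = "\<lambda>v. if finite (S v) \<and> S v \<noteq> {} then pmf_of_set (S v) else return_pmf v"
    have sum_V: "measure_pmf.expectation (walk_law S r k) h = (\<Sum>a\<in>V. h a * pmf (walk_law S r k) a)"
      for h :: "nat \<Rightarrow> real"
      by (rule integral_measure_pmf_real[OF assms(3)]) (use V[of k] in blast)
    have "finite (set_pmf (?K v))" for v by auto
    then have "measure_pmf.expectation (walk_law S r (Suc k)) (walk_average S g l)
      = measure_pmf.expectation (walk_law S r k) (\<lambda>v. measure_pmf.expectation (?K v) (walk_average S g l))"
      unfolding walk_law.simps
      by (subst pmf_expectation_bind[of V]) (use V[of k] assms(3) in \<open>auto simp: sum_V mult.commute\<close>)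
    also have "\<dots> = measure_pmf.expectation (walk_law S r k) (walk_average S g (Suc l))"
    proof (intro integral_cong_AE)
      show "AE v in measure_pmf (walk_law S r k).
          measure_pmf.expectation (?K v) (walk_average S g l) = walk_average S g (Suc l) v"
        using V[of k] assms(1) by (auto simp: AE_measure_pmf_iff integral_pmf_of_set)
    qed simp_all
    also have "\<dots> = walk_average S g (Suc k + l) r" unfolding Suc.IH by simp
    finally show ?case .
  qed simp
qed

lemma relpow_sym: "sym R \<Longrightarrow> (x, y) \<in> R ^^ n \<Longrightarrow> (y, x) \<in> R ^^ n"
proof (induction n arbitrary: y)
  case (Suc n)
  then obtain z where "(x, z) \<in> R ^^ n" "(z, y) \<in> R" by auto
  then show ?case using Suc by (meson relpow_Suc_I2 symD)
qed simp

text \<open>A connected graph in which no vertex is reached by both an even and an odd walk from the root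
  is bipartite; one odd closed walk at the root then gives walks of both parities between any two
  vertices, which can be lengthened by two steps back and forth along an edge.\<close>

lemma uniform_walk_length:
  assumes T: "T \<in> rgraphs" and fin: "finite (verts T)" and nb: "\<not> bipartite T"
    and nonempty: "\<And>v. v \<in> verts T \<Longrightarrow> nbrs T v \<noteq> {}"
  shows "\<exists>K. \<forall>v\<in>verts T. \<forall>w\<in>verts T. (v, w) \<in> adj_rel T ^^ K"
proof -
  let ?R = "adj_rel T" and ?r = "vroot T"
  note g = rgraphsD[OF T]
  have sym: "sym ?R" by (auto simp: sym_def adj_rel_def insert_commute)
  have reach: "\<exists>n. (v, w) \<in> ?R ^^ n" if "v \<in> verts T" "w \<in> verts T" for v w
    using g(3) that by (auto simp: connected_graph_def rtrancl_power)
  have rv: "w \<in> verts T" if "(v, w) \<in> ?R ^^ n" "v \<in> verts T" for v w n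
    using that edge_verts(2)[OF g(1)] by (cases n) (auto simp: adj_rel_def)
  have odd_loop: "\<exists>n. odd n \<and> (?r, ?r) \<in> ?R ^^ n"
  proof (rule ccontr)
    assume no: "\<not> ?thesis"
    let ?A = "{v \<in> verts T. \<exists>n. even n \<and> (?r, v) \<in> ?R ^^ n}"
    let ?B = "{v \<in> verts T. \<exists>n. odd n \<and> (?r, v) \<in> ?R ^^ n}"
    have cover: "?A \<union> ?B = verts T" using reach[OF g(2)] by blast
    have disj: "?A \<inter> ?B = {}"
    proof (rule ccontr)
      assume "?A \<inter> ?B \<noteq> {}"
      then obtain v m n where "even m" "odd n" "(?r, v) \<in> ?R ^^ m" "(?r, v) \<in> ?R ^^ n" by blast
      then have "odd (m + n)" "(?r, ?r) \<in> ?R ^^ (m + n)"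
        using relpow_sym[OF sym] by (auto simp: relpow_add)
      then show False using no by blast
    qed
    have cross: "\<exists>a\<in>?A. \<exists>b\<in>?B. e = {a, b}" if e: "e \<in> edges T" for e
    proof -
      obtain v w where vw: "e = {v, w}" "v \<in> verts T" "w \<in> verts T"
        using e g(1) unfolding simple_graph_def by blast
      obtain n where n: "(?r, v) \<in> ?R ^^ n" using reach[OF g(2) vw(2)] by blast
      have "(?r, w) \<in> ?R ^^ Suc n" using n e vw(1) by (auto simp: adj_rel_def)
      then obtain n' where n': "even n' = odd n" "(?r, w) \<in> ?R ^^ n'"
        by (metis even_Suc)
      show ?thesis
      proof (cases "even n")
        case True
        then have "v \<in> ?A" "w \<in> ?B" using n n' vw(2,3) by blast+
        then show ?thesis using vw by blast
      next
        case False
        then have "v \<in> ?B" "w \<in> ?A" using n n' vw(2,3) by blast+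
        moreover have "e = {w, v}" using vw(1) by (rule trans) (rule insert_commute)
        ultimately show ?thesis by blast
      qed
    qed
    have "bipartite T" unfolding bipartite_def
      by (rule exI[of _ ?A], rule exI[of _ ?B], intro conjI ballI cover disj) (rule cross)
    then show False using nb by blast
  qed
  then obtain l where l: "odd l" "(?r, ?r) \<in> ?R ^^ l" by blast
  have extend: "(v, w) \<in> ?R ^^ (n + 2 * k)" if "(v, w) \<in> ?R ^^ n" "v \<in> verts T" for v w n k
  proof (induction k)
    case (Suc k)
    have "w \<in> verts T" using rv that by blast
    then obtain u where "(w, u) \<in> ?R" using nonempty by (auto simp: nbrs_def adj_rel_def)
    then have "(w, w) \<in> ?R ^^ 2" using sym by (auto simp: numeral_2_eq_2 sym_def)
    then have "(v, w) \<in> ?R ^^ (n + 2 * k + 2)" using Suc unfolding relpow_add by blast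
    then show ?case by (simp add: add.assoc)
  qed (use that in simp)
  have "\<exists>N. \<forall>n\<ge>N. (v, w) \<in> ?R ^^ n" if vw: "v \<in> verts T" "w \<in> verts T" for v w
  proof -
    obtain a where a: "(v, ?r) \<in> ?R ^^ a" using reach[OF vw(1) g(2)] by blast
    obtain b where b: "(?r, w) \<in> ?R ^^ b" using reach[OF g(2) vw(2)] by blast
    have one: "(v, w) \<in> ?R ^^ (a + b)" using a b unfolding relpow_add by blast
    have two: "(v, w) \<in> ?R ^^ (a + b + l)"
    proof -
      have "(v, w) \<in> ?R ^^ (a + l + b)" using a l(2) b unfolding relpow_add by blast
      then show ?thesis by (simp add: ac_simps)
    qed
    have "(v, w) \<in> ?R ^^ n" if "n \<ge> a + b + l" for n
    proof (cases "even (n - (a + b))")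
      case True
      then obtain k where "n - (a + b) = 2 * k" by blast
      then have "n = a + b + 2 * k" using that by simp
      then show ?thesis using extend[OF one vw(1)] by simp
    next
      case False
      then have "even (n - (a + b + l))" using l(1) that by auto
      then obtain k where "n - (a + b + l) = 2 * k" by blast
      then have "n = a + b + l + 2 * k" using that by simp
      then show ?thesis using extend[OF two vw(1)] by simp
    qed
    then show ?thesis by blast
  qed
  then obtain N where N: "\<And>v w n. v \<in> verts T \<Longrightarrow> w \<in> verts T \<Longrightarrow> N v w \<le> n \<Longrightarrow> (v, w) \<in> ?R ^^ n"
    by metis
  let ?K = "Max ((\<lambda>(v, w). N v w) ` (verts T \<times> verts T))"
  have "N v w \<le> ?K" if "v \<in> verts T" "w \<in> verts T" for v w
    by (rule Max_ge) (use fin that in auto)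
  then show ?thesis using N by blast
qed

text \<open>One step of averaging cannot decrease the minimum, and along an edge it passes on at least the
  fraction \<open>1 / D\<close> of the excess over the minimum.\<close>

lemma walk_average_lower_bound:
  assumes S: "\<And>v. v \<in> V \<Longrightarrow> finite (S v) \<and> S v \<noteq> {} \<and> S v \<subseteq> V \<and> card (S v) \<le> D"
    and m: "\<And>u. u \<in> V \<Longrightarrow> m \<le> walk_average S g k u"
    and vw: "v \<in> V" "(v, w) \<in> {(x, y). y \<in> S x} ^^ l"
  shows "m + (walk_average S g k w - m) / real D ^ l \<le> walk_average S g (l + k) v"
proof -
  have low: "m \<le> walk_average S g (l + k) u" if "u \<in> V" for u l
    using that
  proof (induction l arbitrary: u)
    case (Suc l)
    have "real (card (S u)) * m \<le> (\<Sum>x\<in>S u. walk_average S g (l + k) x)"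
      by (rule sum_bounded_below) (use Suc S in blast)
    moreover have "0 < card (S u)" using S[OF Suc.prems] by (simp add: card_gt_0_iff)
    ultimately show ?case by (simp add: field_simps)
  qed (use m in simp)
  show ?thesis using vw
  proof (induction l arbitrary: v)
    case (Suc l)
    obtain u where u: "u \<in> S v" "(u, w) \<in> {(x, y). y \<in> S x} ^^ l"
      using relpow_Suc_D2[OF Suc.prems(2)] by blast
    have uV: "u \<in> V" and Sv: "finite (S v)" "S v \<subseteq> V" and c: "0 < card (S v)" "card (S v) \<le> D"
      using S[OF Suc.prems(1)] u(1) by (auto simp: card_gt_0_iff)
    let ?f = "walk_average S g (l + k)" and ?x = "(walk_average S g k w - m) / real D ^ l"
    have "w \<in> V" using u(2) uV
    proof (induction l arbitrary: w)
      case (Suc l) then show ?case using S by auto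
    qed simp
    then have x: "0 \<le> ?x" using m by simp
    have "?x / real D \<le> ?x / real (card (S v))"
      using x c by (intro divide_left_mono) auto
    also have "\<dots> \<le> (?f u - m) / real (card (S v))"
      using Suc.IH[OF uV u(2)] by (intro divide_right_mono) auto
    also have "\<dots> \<le> (\<Sum>y\<in>S v. ?f y - m) / real (card (S v))"
      by (intro divide_right_mono member_le_sum[OF u(1)]) (use low Sv in auto)
    also have "\<dots> = walk_average S g (Suc l + k) v - m"
      using c by (simp add: sum_subtractf field_simps)
    finally show ?case by (simp add: field_simps)
  qed simp
qed

text \<open>The degree-weighted mean is conserved by the averaging, while the oscillation shrinks by a fixed
  factor every \<open>K\<close> steps, so all averages converge to the degree-weighted mean.\<close>

lemma walk_average_tendsto:
  assumes T: "T \<in> rgraphs" and fin: "finite (verts T)" and nb: "\<not> bipartite T"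
    and nonempty: "\<And>v. v \<in> verts T \<Longrightarrow> nbrs T v \<noteq> {}" and r: "r \<in> verts T"
  shows "(\<lambda>k. walk_average (nbrs T) g k r) \<longlonglongrightarrow>
    (\<Sum>v\<in>verts T. real (deg T v) * g v) / (\<Sum>v\<in>verts T. real (deg T v))"
proof -
  let ?V = "verts T" and ?f = "walk_average (nbrs T) g"
  note g = rgraphsD[OF T]
  obtain K where K: "\<And>v w. v \<in> ?V \<Longrightarrow> w \<in> ?V \<Longrightarrow> (v, w) \<in> adj_rel T ^^ K"
    using uniform_walk_length[OF T fin nb nonempty] by blast
  have S: "finite (nbrs T v) \<and> nbrs T v \<noteq> {} \<and> nbrs T v \<subseteq> ?V \<and> card (nbrs T v) \<le> card ?V"
    if "v \<in> ?V" for v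
    using that nonempty g nbrs_subset_verts[OF g(1)] card_mono[OF fin] by blast
  have adj: "adj_rel T = {(x, y). y \<in> nbrs T x}" by (auto simp: adj_rel_def nbrs_def)
  have dpos: "0 < deg T v" if "v \<in> ?V" for v
    using S[OF that] by (simp add: deg_def card_gt_0_iff)
  define D where "D = real (card ?V)"
  have D: "1 \<le> D" using r fin by (simp add: D_def Suc_le_eq card_gt_0_iff) blast
  define m M where "m k = Min (?f k ` ?V)" and "M k = Max (?f k ` ?V)" for k
  have V: "?V \<noteq> {}" using r by blast
  have mM: "m k \<le> ?f k v" "?f k v \<le> M k" if "v \<in> ?V" for k v
    using fin that by (auto simp: m_def M_def)
  have m_ge: "\<exists>v\<in>?V. m k = ?f k v" and M_ge: "\<exists>v\<in>?V. M k = ?f k v" for k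
  proof -
    have "m k \<in> ?f k ` ?V" "M k \<in> ?f k ` ?V" unfolding m_def M_def
      by (intro Min_in Max_in; use fin V in simp)+
    then show "\<exists>v\<in>?V. m k = ?f k v" "\<exists>v\<in>?V. M k = ?f k v" by auto
  qed
  have step: "m k \<le> m (Suc k) \<and> M (Suc k) \<le> M k" for k
  proof -
    have "m k \<le> ?f (Suc k) v \<and> ?f (Suc k) v \<le> M k" if v: "v \<in> ?V" for v
    proof -
      have "real (card (nbrs T v)) * m k \<le> (\<Sum>x\<in>nbrs T v. ?f k x)"
        by (rule sum_bounded_below) (use S[OF v] mM in blast)
      moreover have "(\<Sum>x\<in>nbrs T v. ?f k x) \<le> real (card (nbrs T v)) * M k"
        by (rule sum_bounded_above) (use S[OF v] mM in blast)
      moreover have "0 < card (nbrs T v)" using dpos[OF v] by (simp add: deg_def)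
      ultimately show ?thesis by (simp add: field_simps)
    qed
    then show ?thesis using m_ge[of "Suc k"] M_ge[of "Suc k"] by auto
  qed
  \<comment> \<open>A walk of length \<open>K\<close> leads from a minimizer at time \<open>K + k\<close> to a maximizer at time \<open>k\<close>.\<close>
  have contract: "M (K + k) - m (K + k) \<le> (1 - 1 / D ^ K) * (M k - m k)" for k
  proof -
    obtain w where w: "w \<in> ?V" "M k = ?f k w" using M_ge by blast
    obtain v where v: "v \<in> ?V" "m (K + k) = ?f (K + k) v" using m_ge by blast
    have "m k + (?f k w - m k) / D ^ K \<le> ?f (K + k) v"
      unfolding D_def using walk_average_lower_bound[of ?V "nbrs T", OF S mM(1) v(1)] K[OF v(1) w(1)]
      unfolding adj by blast
    moreover have "M (K + k) \<le> M k"
      using lift_Suc_antimono_le[of M k "K + k"] step by simp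
    moreover have "M' - m' \<le> (a - b) - x" if "b + x \<le> m'" "M' \<le> a" for a b x m' M' :: real
      using that by linarith
    moreover have "(1 - 1 / D ^ K) * (M k - m k) = (M k - m k) - (M k - m k) / D ^ K"
      by (simp add: left_diff_distrib)
    ultimately show ?thesis unfolding w(2)[symmetric] v(2)[symmetric] by presburger
  qed
  define c where "c = 1 - 1 / D ^ K"
  have DK: "1 \<le> D ^ K" using D by (rule one_le_power)
  then have c: "0 \<le> c" "c < 1" by (auto simp: c_def divide_le_eq)
  define osc where "osc k = M k - m k" for k
  have osc0: "0 \<le> osc k" for k using mM[OF r, of k] by (simp add: osc_def)
  have osc_pow: "osc (K * n) \<le> c ^ n * osc 0" for n
  proof (induction n)
    case (Suc n)
    have "osc (K * Suc n) \<le> c * osc (K * n)" using contract[of "K * n"] by (simp add: osc_def c_def)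
    also have "\<dots> \<le> c * (c ^ n * osc 0)" using Suc c by (intro mult_left_mono) auto
    finally show ?case by simp
  qed simp
  have "(\<lambda>n. c ^ n * osc 0) \<longlonglongrightarrow> 0"
    using tendsto_mult_right[OF LIMSEQ_realpow_zero[OF c], of "osc 0"] by simp
  then have lim0: "(\<lambda>n. osc (K * n)) \<longlonglongrightarrow> 0"
    by (rule tendsto_sandwich[OF _ _ tendsto_const, rotated -1]) (use osc0 osc_pow in auto)
  have osc_mono: "osc k' \<le> osc k" if "k \<le> k'" for k k'
    using lift_Suc_antimono_le[of osc k k'] step that by (simp add: osc_def) (meson diff_mono)
  have osc_lim: "osc \<longlonglongrightarrow> 0"
  proof (rule LIMSEQ_I)
    fix e :: real assume "0 < e"
    then obtain n where n: "osc (K * n) < e"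
      using LIMSEQ_D[OF lim0, of e] osc0 by auto
    show "\<exists>N. \<forall>k\<ge>N. norm (osc k - 0) < e"
      using osc0 osc_mono n by (intro exI[of _ "K * n"]) (auto intro: le_less_trans)
  qed
  let ?Z = "\<Sum>v\<in>?V. real (deg T v)"
  have Z: "0 < ?Z" by (rule sum_pos) (use fin V dpos in auto)
  have conserve: "(\<Sum>v\<in>?V. real (deg T v) * ?f k v) = (\<Sum>v\<in>?V. real (deg T v) * g v)" for k
  proof (induction k)
    case (Suc k)
    have nb_sum: "(\<Sum>u\<in>nbrs T v. h u) = (\<Sum>u\<in>?V. if u \<in> nbrs T v then h u else 0)" for h :: "nat \<Rightarrow> real" and v
      using fin nbrs_subset_verts[OF g(1), of v] by (simp add: sum.If_cases Int_absorb1)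
    have "(\<Sum>v\<in>?V. real (deg T v) * ?f (Suc k) v) = (\<Sum>v\<in>?V. \<Sum>u\<in>nbrs T v. ?f k u)"
      using dpos by (intro sum.cong refl) (simp add: deg_def)
    also have "\<dots> = (\<Sum>u\<in>?V. \<Sum>v\<in>?V. if u \<in> nbrs T v then ?f k u else 0)"
      unfolding nb_sum by (rule sum.swap)
    also have "\<dots> = (\<Sum>u\<in>?V. \<Sum>v\<in>nbrs T u. ?f k u)"
      unfolding nb_sum by (intro sum.cong refl) (simp add: nbrs_commute)
    also have "\<dots> = (\<Sum>v\<in>?V. real (deg T v) * ?f k v)" by (simp add: deg_def)
    finally show ?case using Suc by simp
  qed simp
  let ?\<pi> = "(\<Sum>v\<in>?V. real (deg T v) * g v) / ?Z"
  have near: "\<bar>?f k r - ?\<pi>\<bar> \<le> osc k" for k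
  proof -
    have "m k * ?Z \<le> (\<Sum>v\<in>?V. real (deg T v) * ?f k v)"
      unfolding sum_distrib_left
      by (intro sum_mono) (subst mult.commute, intro mult_left_mono mM, auto)
    moreover have "(\<Sum>v\<in>?V. real (deg T v) * ?f k v) \<le> M k * ?Z"
      unfolding sum_distrib_left
      by (intro sum_mono) (subst mult.commute, intro mult_right_mono mM, auto)
    ultimately have "m k \<le> ?\<pi>" "?\<pi> \<le> M k"
      unfolding conserve using Z by (auto simp: field_simps)
    then show ?thesis using mM[OF r, of k] by (simp add: osc_def abs_le_iff)
  qed
  have "(\<lambda>k. ?f k r - ?\<pi>) \<longlonglongrightarrow> 0"
    by (rule Lim_null_comparison[OF _ osc_lim]) (use near in auto)
  then show ?thesis by (rule LIM_zero_cancel)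
qed

lemma backtracking_bias_tendsto:
  assumes T: "T \<in> rgraphs" and fin: "finite (verts T)" and nb: "\<not> bipartite T"
    and nontrivial: "\<exists>v\<in>verts T. v \<noteq> vroot T"
  shows "(\<lambda>k. backtracking_bias k T) \<longlonglongrightarrow> stationary_bias T"
proof -
  note g = rgraphsD[OF T]
  have ne: "nbrs T v \<noteq> {}" if v: "v \<in> verts T" for v
  proof -
    obtain w where "w \<in> verts T" "w \<noteq> v" using nontrivial g(2) by metis
    then have "(v, w) \<in> (adj_rel T)\<^sup>*" using g(3) v by (auto simp: connected_graph_def)
    then obtain u where "(v, u) \<in> adj_rel T" using \<open>w \<noteq> v\<close> by (metis converse_rtranclE)
    then show ?thesis by (auto simp: adj_rel_def nbrs_def)
  qed
  have S: "finite (nbrs T v) \<and> nbrs T v \<noteq> {} \<and> nbrs T v \<subseteq> verts T" if "v \<in> verts T" for v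
    using ne that g nbrs_subset_verts[OF g(1)] by blast
  have "backtracking_bias k T = walk_average (nbrs T) (\<lambda>v. real (deg T v)) k (vroot T) - real (deg T (vroot T))" for k
  proof -
    let ?p = "walk_law (nbrs T) (vroot T) k"
    have "(\<Sum>j\<in>set_pmf ?p. pmf ?p j * real (deg T j)) = measure_pmf.expectation ?p (\<lambda>j. real (deg T j))"
      by (subst integral_measure_pmf_real[OF finite_set_walk_law]) (auto simp: mult.commute)
    also have "\<dots> = measure_pmf.expectation ?p (walk_average (nbrs T) (\<lambda>v. real (deg T v)) 0)" 
      by (simp add: fun_eq_iff cong: Bochner_Integration.integral_cong)
    also have "\<dots> = walk_average (nbrs T) (\<lambda>v. real (deg T v)) k (vroot T)"
      using expectation_walk_law(2)[OF S g(2) fin, where l=0] by simp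
    finally show ?thesis unfolding backtracking_bias_def bias_eq_suminf(2)[OF T] by simp
  qed
  moreover have "(\<lambda>k. walk_average (nbrs T) (\<lambda>v. real (deg T v)) k (vroot T) - real (deg T (vroot T)))
      \<longlonglongrightarrow> stationary_bias T"
    unfolding stationary_bias_def power2_eq_square
    by (intro tendsto_diff tendsto_const walk_average_tendsto[OF T fin nb ne g(2)])
  ultimately show ?thesis by simp
qed

section \<open>Weak convergence\<close>

lemma measurable_cts_step: "a < b \<Longrightarrow> cts_step a b \<in> borel_measurable borel"
  by (intro borel_measurable_continuous_onI uniformly_continuous_imp_continuous
      cts_step_uniformly_continuous)

text \<open>Convergence of the expectations of the piecewise linear functions \<open>cts_step\<close> is enough for weak
  convergence.\<close>

lemma weak_conv_m_distrI:
  fixes X :: "nat \<Rightarrow> 'a \<Rightarrow> real"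
  assumes M: "prob_space M" and [measurable]: "\<And>k. X k \<in> borel_measurable M" "Y \<in> borel_measurable M"
    and lim: "\<And>a b. a < b \<Longrightarrow>
      (\<lambda>k. \<integral>\<omega>. cts_step a b (X k \<omega>) \<partial>M) \<longlonglongrightarrow> (\<integral>\<omega>. cts_step a b (Y \<omega>) \<partial>M)"
  shows "weak_conv_m (\<lambda>k. distr M borel (X k)) (distr M borel Y)"
proof -
  interpret prob_space M by fact
  show ?thesis
  proof (rule integral_cts_step_conv_imp_weak_conv)
    fix a b :: real assume ab: "a < b"
    note [measurable] = measurable_cts_step[OF ab]
    show "(\<lambda>n. \<integral>x. cts_step a b x \<partial>distr M borel (X n)) \<longlonglongrightarrow> (\<integral>x. cts_step a b x \<partial>distr M borel Y)"
      using lim[OF ab] by (simp add: integral_distr)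
  qed simp_all
qed

lemma cts_step_bounds: "a < b \<Longrightarrow> 0 \<le> cts_step a b x \<and> cts_step a b x \<le> 1"
  by (auto simp: cts_step_def divide_le_eq)

lemma cts_step_lipschitz: "a < b \<Longrightarrow> \<bar>cts_step a b x - cts_step a b y\<bar> \<le> \<bar>x - y\<bar> / (b - a)"
  by (auto simp: cts_step_def divide_simps abs_if)

lemma AE_tendsto_imp_weak_conv:
  fixes X :: "nat \<Rightarrow> 'a \<Rightarrow> real"
  assumes M: "prob_space M" and [measurable]: "\<And>k. X k \<in> borel_measurable M" "Y \<in> borel_measurable M"
    and lim: "AE \<omega> in M. (\<lambda>k. X k \<omega>) \<longlonglongrightarrow> Y \<omega>"
  shows "weak_conv_m (\<lambda>k. distr M borel (X k)) (distr M borel Y)"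
proof (rule weak_conv_m_distrI[OF M])
  interpret prob_space M by fact
  fix a b :: real assume ab: "a < b"
  note [measurable] = measurable_cts_step[OF ab]
  have cont: "isCont (cts_step a b) x" for x
    using uniformly_continuous_imp_continuous[OF cts_step_uniformly_continuous[OF ab]]
    by (simp add: continuous_on_eq_continuous_at)
  show "(\<lambda>k. \<integral>\<omega>. cts_step a b (X k \<omega>) \<partial>M) \<longlonglongrightarrow> (\<integral>\<omega>. cts_step a b (Y \<omega>) \<partial>M)"
  proof (rule integral_dominated_convergence[where w="\<lambda>_. 1"])
    show "AE \<omega> in M. (\<lambda>k. cts_step a b (X k \<omega>)) \<longlonglongrightarrow> cts_step a b (Y \<omega>)"
      using lim by eventually_elim (rule isCont_tendsto_compose[OF cont])
    show "AE \<omega> in M. norm (cts_step a b (X k \<omega>)) \<le> 1" for k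
      using cts_step_bounds[OF ab] by simp
  qed simp_all
qed simp_all

text \<open>The test functions are Lipschitz and take values in the unit interval, so the expectations differ
  by at most \<open>\<delta> / (b - a)\<close> plus the probability of a deviation of more than \<open>\<delta>\<close>.\<close>

lemma conv_in_prob_imp_weak_conv:
  assumes M: "prob_space M" and [measurable]: "\<And>k. X k \<in> borel_measurable M" "Y \<in> borel_measurable M"
    and conv: "conv_in_prob M X Y"
  shows "weak_conv_m (\<lambda>k. distr M borel (X k)) (distr M borel Y)"
proof (rule weak_conv_m_distrI[OF M])
  interpret prob_space M by fact
  fix a b :: real assume ab: "a < b"
  note [measurable] = measurable_cts_step[OF ab]
  have int: "integrable M (\<lambda>\<omega>. cts_step a b (Z \<omega>))" if [measurable]: "Z \<in> borel_measurable M" for Z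
    by (rule integrable_const_bound[of _ 1]) (use cts_step_bounds[OF ab] in auto)
  have bound: "\<bar>(\<integral>\<omega>. cts_step a b (X k \<omega>) \<partial>M) - (\<integral>\<omega>. cts_step a b (Y \<omega>) \<partial>M)\<bar>
      \<le> \<delta> / (b - a) + prob {\<omega> \<in> space M. \<delta> < \<bar>X k \<omega> - Y \<omega>\<bar>}" if \<delta>: "0 < \<delta>" for \<delta> k
  proof -
    let ?E = "{\<omega> \<in> space M. \<delta> < \<bar>X k \<omega> - Y \<omega>\<bar>}"
    have "\<bar>(\<integral>\<omega>. cts_step a b (X k \<omega>) \<partial>M) - (\<integral>\<omega>. cts_step a b (Y \<omega>) \<partial>M)\<bar>
        = \<bar>\<integral>\<omega>. cts_step a b (X k \<omega>) - cts_step a b (Y \<omega>) \<partial>M\<bar>"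
      using int by simp
    also have "\<dots> \<le> (\<integral>\<omega>. \<bar>cts_step a b (X k \<omega>) - cts_step a b (Y \<omega>)\<bar> \<partial>M)"
      by (rule integral_abs_bound)
    also have "\<dots> \<le> (\<integral>\<omega>. \<delta> / (b - a) + indicator ?E \<omega> \<partial>M)"
    proof (rule integral_mono)
      show "integrable M (\<lambda>\<omega>. \<bar>cts_step a b (X k \<omega>) - cts_step a b (Y \<omega>)\<bar>)" using int by simp
      show "integrable M (\<lambda>\<omega>. \<delta> / (b - a) + indicator ?E \<omega>)"
        by (intro Bochner_Integration.integrable_add) (auto simp: emeasure_eq_measure)
      fix \<omega> assume \<omega>: "\<omega> \<in> space M"
      show "\<bar>cts_step a b (X k \<omega>) - cts_step a b (Y \<omega>)\<bar> \<le> \<delta> / (b - a) + indicator ?E \<omega>"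
      proof (cases "\<omega> \<in> ?E")
        case True
        have "\<bar>cts_step a b (X k \<omega>) - cts_step a b (Y \<omega>)\<bar> \<le> 1"
          using cts_step_bounds[OF ab, of "X k \<omega>"] cts_step_bounds[OF ab, of "Y \<omega>"] by linarith
        also have "1 \<le> \<delta> / (b - a) + 1" using \<delta> ab by simp
        finally show ?thesis using True by simp
      next
        case False
        have "\<bar>cts_step a b (X k \<omega>) - cts_step a b (Y \<omega>)\<bar> \<le> \<bar>X k \<omega> - Y \<omega>\<bar> / (b - a)"
          by (rule cts_step_lipschitz[OF ab])
        also have "\<dots> \<le> \<delta> / (b - a)" using False \<omega> ab by (intro divide_right_mono) auto
        finally show ?thesis using False by simp
      qed
    qed
    also have "\<dots> = \<delta> / (b - a) + prob ?E"
      by (subst Bochner_Integration.integral_add) (auto simp: prob_space emeasure_eq_measure)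
    finally show ?thesis .
  qed
  show "(\<lambda>k. \<integral>\<omega>. cts_step a b (X k \<omega>) \<partial>M) \<longlonglongrightarrow> (\<integral>\<omega>. cts_step a b (Y \<omega>) \<partial>M)"
  proof (rule LIMSEQ_I)
    fix e :: real assume e: "0 < e"
    define \<delta> where "\<delta> = (e / 2) * (b - a)"
    have "0 < \<delta>" using e ab by (simp add: \<delta>_def)
    moreover have "\<delta> / (b - a) = e / 2"
      unfolding \<delta>_def by (rule nonzero_mult_div_cancel_right) (use ab in simp)
    ultimately have \<delta>: "0 < \<delta>" "\<delta> / (b - a) = e / 2" by blast+
    have "(\<lambda>k. prob {\<omega> \<in> space M. \<delta> < \<bar>X k \<omega> - Y \<omega>\<bar>}) \<longlonglongrightarrow> 0"
      using conv \<delta>(1) by (simp add: conv_in_prob_def)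
    from LIMSEQ_D[OF this, of "e / 2"] obtain N where
      N: "\<And>k. N \<le> k \<Longrightarrow> prob {\<omega> \<in> space M. \<delta> < \<bar>X k \<omega> - Y \<omega>\<bar>} < e / 2" using e by auto
    have "norm ((\<integral>\<omega>. cts_step a b (X k \<omega>) \<partial>M) - (\<integral>\<omega>. cts_step a b (Y \<omega>) \<partial>M)) < e" if "N \<le> k" for k
      using bound[OF \<delta>(1), of k] N[OF that] \<delta>(2) by simp
    then show "\<exists>N. \<forall>k\<ge>N. norm ((\<integral>\<omega>. cts_step a b (X k \<omega>) \<partial>M) - (\<integral>\<omega>. cts_step a b (Y \<omega>) \<partial>M)) < e"
      by blast
  qed
qed simp_all

section \<open>The two limits\<close>

text \<open>The neighbours of the root are the labels from 1 to its degree, and their degrees are independent of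
  that number.\<close>

lemma expectation_joint_degree_count:
  assumes L: "prob_space L" and sL: "sets L = sets rgraph_space"
    and reg: "AE T in L. regular_bfs_tree T"
    and ind: "prob_space.indep_vars L (\<lambda>_. count_space UNIV) (\<lambda>i. if i = 0 then (\<lambda>T. deg T (vroot T)) else (\<lambda>T. noff T i)) UNIV"
    and ident: "\<And>i. 1 \<le> i \<Longrightarrow> distr L (count_space UNIV) (\<lambda>T. noff T i) = distr L (count_space UNIV) (\<lambda>T. noff T 1)"
  shows "(\<integral>T. joint_degree_count a b T (vroot T) \<partial>L) =
    real a * measure L {T \<in> space L. deg T (vroot T) = a} * measure L {T \<in> space L. noff T 1 + 1 = b}"
proof -
  interpret prob_space L by fact
  let ?X = "\<lambda>i. if i = 0 then (\<lambda>T. deg T (vroot T)) else (\<lambda>T. noff T i)"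
  have X: "?X i \<in> L \<rightarrow>\<^sub>M count_space UNIV" for i
    by (rule bspec[OF conjunct1[OF ind[unfolded indep_vars_def2]]]) simp
  have [measurable]: "(\<lambda>T. deg T (vroot T)) \<in> L \<rightarrow>\<^sub>M count_space UNIV" using X[of 0] by simp
  have noff [measurable]: "(\<lambda>T. noff T i) \<in> L \<rightarrow>\<^sub>M count_space UNIV" if "1 \<le> i" for i
    using X[of i] that by simp
  let ?E = "\<lambda>i. {T \<in> space L. deg T (vroot T) = a} \<inter> {T \<in> space L. noff T i + 1 = b}"
  have E: "?E i \<in> events" if "1 \<le> i" for i
    using noff[OF that] by measurable
  have pE: "prob (?E i) = prob {T \<in> space L. deg T (vroot T) = a} * prob {T \<in> space L. noff T 1 + 1 = b}"
    if i: "1 \<le> i" for i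
  proof -
    have "prob (\<Inter>j\<in>{0, i}. ?X j -` (if j = 0 then {a} else {n. n + 1 = b}) \<inter> space L)
        = (\<Prod>j\<in>{0, i}. prob (?X j -` (if j = 0 then {a} else {n. n + 1 = b}) \<inter> space L))"
      by (rule indep_varsD[OF ind]) auto
    moreover have "(\<lambda>T. deg T (vroot T)) -` {a} \<inter> space L = {T \<in> space L. deg T (vroot T) = a}" by auto
    moreover have pre: "(\<lambda>T. noff T i) -` {n. n + 1 = b} \<inter> space L = {T \<in> space L. noff T i + 1 = b}" for i by auto
    moreover have "prob {T \<in> space L. noff T i + 1 = b} = prob {T \<in> space L. noff T 1 + 1 = b}"
    proof -
      have m: "measure (distr L (count_space UNIV) (\<lambda>T. noff T i)) {n. n + 1 = b} = prob {T \<in> space L. noff T i + 1 = b}"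
        if "1 \<le> i" for i
        unfolding pre[symmetric] by (rule measure_distr[OF noff[OF that]]) simp
      show ?thesis unfolding m[OF i, symmetric] m[OF order_refl, symmetric] ident[OF i] ..
    qed
    ultimately show ?thesis using i by simp
  qed
  have "(\<integral>T. joint_degree_count a b T (vroot T) \<partial>L) = (\<integral>T. (\<Sum>i=1..a. indicator (?E i) T) \<partial>L)"
  proof (rule integral_cong_AE)
    show "(\<lambda>T. joint_degree_count a b T (vroot T)) \<in> borel_measurable L"
      using measurable_joint_degree_count measurable_cong_sets[OF sL refl] by blast
    show "(\<lambda>T. \<Sum>i=1..a. indicator (?E i) T :: real) \<in> borel_measurable L"
      by (intro borel_measurable_sum borel_measurable_indicator E) simp
    show "AE T in L. joint_degree_count a b T (vroot T) = (\<Sum>i=1..a. indicator (?E i) T)"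
      using reg AE_space
    proof eventually_elim
      case (elim T)
      note r = regular_root[OF elim(1)]
      show ?case
      proof (cases "deg T (vroot T) = a")
        case True
        have "{w \<in> nbrs T 0. deg T w = b} = {i \<in> {1..a}. noff T i + 1 = b}"
          using regular_nbrs_root[OF elim(1)] regular_deg[OF elim(1)] True r by auto
        moreover have "(\<Sum>i=1..a. indicator (?E i) T :: real) = (\<Sum>i=1..a. of_bool (noff T i + 1 = b))"
          by (intro sum.cong refl) (use True elim in \<open>auto simp: indicator_def\<close>)
        ultimately show ?thesis using True r
          by (simp add: joint_degree_count_def of_bool_def sum.If_cases Int_def)
      qed (simp add: joint_degree_count_def)
    qed
  qed
  also have "\<dots> = (\<Sum>i=1..a. prob (?E i))"
    using E by (subst Bochner_Integration.integral_sum) (auto simp: emeasure_eq_measure)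
  also have "\<dots> = real a * prob {T \<in> space L. deg T (vroot T) = a} * prob {T \<in> space L. noff T 1 + 1 = b}"
    by (subst sum.cong[OF refl pE]) auto
  finally show ?thesis .
qed

lemma nonbacktracking_limit:
  assumes P: "prob_space P"
    and G: "\<forall>n\<ge>3. G n \<in> measurable P (count_space {H. verts H = {1..n} \<and> simple_graph H})"
    and L: "L \<in> space (prob_algebra rgraph_space)"
    and tree: "AE T in L. is_tree T \<and> infinite (verts T) \<and> (\<forall>v\<in>verts T. 1 \<le> noff T v) \<and> bfs_labelled T"
    and conv: "local_conv_in_prob P G (\<lambda>_. L)"
    and min: "\<forall>\<^sub>F n in sequentially. AE x in P. \<forall>i\<in>{1..n}. 3 \<le> deg (G n x) i"
    and root: "prob_space.indep_set L
        (sets (vimage_algebra (space L) (\<lambda>T. deg T (vroot T)) (count_space UNIV)))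
        (sets (vimage_algebra (space L) (\<lambda>T. \<lambda>i\<in>{1..}. noff T i) (PiM {1..} (\<lambda>_. count_space UNIV))))"
    and noff: "prob_space.indep_vars L (\<lambda>_. count_space UNIV) (\<lambda>i T. noff T i) {1..}"
    and ident: "\<forall>i\<ge>1. distr L (count_space UNIV) (\<lambda>T. noff T i) = distr L (count_space UNIV) (\<lambda>T. noff T 1)"
    and sq: "\<forall>i\<ge>1. integrable L (\<lambda>T. (real (noff T i))\<^sup>2)"
    and \<Delta>: "\<Delta> = (\<lambda>T. (\<integral>T. (real (deg T (vroot T)))\<^sup>2 \<partial>L) / (\<integral>T. real (deg T (vroot T)) \<partial>L)
      - real (deg T (vroot T)))"
  shows "conv_in_prob L nonbacktracking_bias \<Delta>"
    and "\<Delta> \<in> borel_measurable L"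
proof -
  have Lp: "prob_space L" and sL: "sets L = sets rgraph_space"
    using L by (auto simp: space_prob_algebra)
  interpret prob_space L by (rule Lp)
  have spL: "space L = rgraphs" using sets_eq_imp_space_eq[OF sL] by simp
  have [measurable]: "(\<lambda>T. deg T (vroot T)) \<in> L \<rightarrow>\<^sub>M count_space UNIV"
    using measurable_deg_root measurable_cong_sets[OF sL refl] by blast
  show \<Delta>m: "\<Delta> \<in> borel_measurable L" unfolding \<Delta> by measurable
  have reg: "AE T in L. regular_bfs_tree T"
    using tree AE_space
  proof eventually_elim
    case (elim T)
    then show ?case by (auto simp: regular_bfs_tree_def spL bfs_labelled_def)
  qed
  note ind = indep_vars_prepend[OF root noff]
  have nm [measurable]: "(\<lambda>T. noff T i) \<in> L \<rightarrow>\<^sub>M count_space UNIV" if "1 \<le> i" for i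
    using noff that by (auto simp: indep_vars_def2)
  have ident': "distr L (count_space UNIV) (\<lambda>T. noff T i) = distr L (count_space UNIV) (\<lambda>T. noff T 1)"
    if "1 \<le> i" for i using ident that by blast
  note count = expectation_joint_degree_count[OF Lp sL reg ind ident']
  have pos: "AE T in L. 1 \<le> deg T (vroot T)"
    using reg
  proof eventually_elim
    case (elim T)
    then show ?case using regular_deg_root regular_noff_pos regular_root by metis
  qed
  have [measurable]: "(\<lambda>T. noff T 1 + 1) \<in> L \<rightarrow>\<^sub>M count_space UNIV"
    using nm[OF order_refl] by measurable
  define q where "q = expectation (\<lambda>T. real (noff T 1))"
  have transfer: "expectation (\<lambda>T. h (noff T i)) = expectation (\<lambda>T. h (noff T 1))"
    if "1 \<le> i" for i and h :: "nat \<Rightarrow> real"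
    using arg_cong[OF ident'[OF that], of "\<lambda>D. \<integral>n. h n \<partial>D"] nm that by (simp add: integral_distr)
  have i1: "integrable L (\<lambda>T. real (noff T 1))"
    by (rule square_integrable_imp_integrable) (use sq nm[OF order_refl] in auto)
  have ratio: "(\<integral>T. (real (deg T (vroot T)))\<^sup>2 \<partial>L) / (\<integral>T. real (deg T (vroot T)) \<partial>L) = q + 1"
  proof -
    have "(\<integral>T. (real (deg T (vroot T)))\<^sup>2 \<partial>L) / (\<integral>T. real (deg T (vroot T)) \<partial>L)
        = expectation (\<lambda>T. real (noff T 1 + 1))"
    proof (rule size_biased_mean[OF _ _ _ pos])
      show "real a * prob {T \<in> space L. deg T (vroot T) = a} * prob {T \<in> space L. noff T 1 + 1 = b}
          = real b * prob {T \<in> space L. deg T (vroot T) = b} * prob {T \<in> space L. noff T 1 + 1 = a}" for a b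
        using local_limit_mass_transport[OF P G conv, of a b] count by simp
    qed measurable
    also have "\<dots> = q + 1" using i1 by (simp add: q_def prob_space)
    finally show ?thesis .
  qed
  have "AE T in L. \<forall>i\<in>{1..}. 2 \<le> noff T i"
  proof (subst AE_ball_countable)
    \<comment> \<open>A neighbour of the root with a single child would have degree 2.\<close>
    obtain a where a: "prob {T \<in> space L. deg T (vroot T) = a} \<noteq> 0" "1 \<le> a"
      using nat_valued_charges[OF _ pos] by auto
    have "real a * prob {T \<in> space L. deg T (vroot T) = a} * prob {T \<in> space L. noff T 1 + 1 = 2} = 0"
      using local_limit_no_low_degree[OF P G conv min, of 2 a] count by simp
    then have one: "prob {T \<in> space L. noff T 1 = 1} = 0" using a by simp
    show "\<forall>i\<in>{1..}. AE T in L. 2 \<le> noff T i"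
    proof
      fix i :: nat assume "i \<in> {1..}"
      then have i: "1 \<le> i" by simp
      have "expectation (\<lambda>T. of_bool (noff T i = 1) :: real) = 0"
      proof -
        have "expectation (\<lambda>T. of_bool (noff T 1 = 1) :: real) = expectation (indicator {T \<in> space L. noff T 1 = 1})"
          by (rule Bochner_Integration.integral_cong) (auto simp: indicator_def)
        also have "\<dots> = prob {T \<in> space L. noff T 1 = 1}"
          by (simp add: Int_absorb2)
        finally show ?thesis using transfer[OF i, of "\<lambda>n. of_bool (n = 1)"] one nm[OF order_refl] by simp
      qed
      moreover have "integrable L (\<lambda>T. of_bool (noff T i = 1) :: real)"
        by (rule integrable_const_bound[of _ 1]) (use nm[OF i] in auto)
      ultimately have "AE T in L. of_bool (noff T i = 1) = (0 :: real)"
        by (subst (asm) integral_nonneg_eq_0_iff_AE) auto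
      with reg show "AE T in L. 2 \<le> noff T i"
      proof eventually_elim
        case (elim T)
        then show ?case using regular_noff_pos[OF elim(1), of i] by simp
      qed
    qed
  qed simp
  then have two: "AE T in L. \<forall>v\<ge>1. 2 \<le> noff T v" by eventually_elim simp
  define s where "s = expectation (\<lambda>T. (real (noff T 1) - q)\<^sup>2)"
  have moment: "(\<integral>\<^sup>+T. ennreal ((nonbacktracking_bias (Suc k) T - \<Delta> T)\<^sup>2) \<partial>L) \<le> ennreal (s / 2 ^ k)" for k
    unfolding \<Delta> ratio
  proof (rule nonbacktracking_bias_second_moment[OF Lp reg ind _ _ _ two])
    show "integrable L (\<lambda>T. (real (noff T j))\<^sup>2)" if "1 \<le> j" for j using sq that by simp
    show "expectation (\<lambda>T. real (noff T j)) = q" if "1 \<le> j" for j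
      unfolding q_def by (rule transfer[OF that])
    show "expectation (\<lambda>T. (real (noff T j) - q)\<^sup>2) = s" if "1 \<le> j" for j
      unfolding s_def by (rule transfer[OF that])
  qed
  show "conv_in_prob L nonbacktracking_bias \<Delta>"
  proof (rule conv_in_prob_if_second_moment[where Y=nonbacktracking_bias and Z=\<Delta> and b="\<lambda>k. s / 2 ^ k",
        OF Lp _ \<Delta>m moment])
    show "nonbacktracking_bias k \<in> borel_measurable L" for k
      using measurable_nonbacktracking_bias measurable_cong_sets[OF sL refl] by blast
    show "(\<lambda>k. s / 2 ^ k) \<longlonglongrightarrow> 0"
      using tendsto_mult[OF tendsto_const[of s] LIMSEQ_realpow_zero[of "1/2"]] by (simp add: power_one_over)
    have "0 \<le> s" unfolding s_def by (rule integral_nonneg_AE) simp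
    then show "0 \<le> s / 2 ^ k" for k by simp
  qed
qed

theorem theorem3p4:
  fixes P :: "'w measure"
    and G :: "nat \<Rightarrow> 'w \<Rightarrow> ugraph"
    and L :: "rgraph measure"
    and \<Lambda> :: "'w \<Rightarrow> rgraph measure"
    and m1 m2 :: real
    and \<Delta> :: "rgraph \<Rightarrow> real"
  assumes P: "prob_space P"
    and m1: "m1 = (\<integral>T. real (deg T (vroot T)) \<partial>L)"
    and m2: "m2 = (\<integral>T. (real (deg T (vroot T)))\<^sup>2 \<partial>L)"
    and \<Delta>: "\<Delta> = (\<lambda>T. m2 / m1 - real (deg T (vroot T)))"
  shows
    "((\<forall>n\<ge>3. G n \<in> measurable P (count_space {H. verts H = {1..n} \<and> simple_graph H})) \<and>
      (\<forall>n\<ge>3. AE x in P. \<forall>i\<in>{1..n}. 2 \<le> deg (G n x) i) \<and>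
      L \<in> space (prob_algebra rgraph_space) \<and>
      (AE T in L. is_tree T \<and> infinite (verts T) \<and> (\<forall>v\<in>verts T. 1 \<le> noff T v) \<and> bfs_labelled T) \<and>
      local_conv_in_prob P G (\<lambda>_. L) \<and>
      (\<forall>\<^sub>F n in sequentially. AE x in P. \<forall>i\<in>{1..n}. 3 \<le> deg (G n x) i) \<and>
      prob_space.indep_set L
        (sets (vimage_algebra (space L) (\<lambda>T. deg T (vroot T)) (count_space UNIV)))
        (sets (vimage_algebra (space L) (\<lambda>T. \<lambda>i\<in>{1..}. noff T i)
                 (PiM {1..} (\<lambda>_. count_space UNIV)))) \<and>
      prob_space.indep_vars L (\<lambda>_. count_space UNIV) (\<lambda>i T. noff T i) {1..} \<and>
      (\<forall>i\<ge>1. distr L (count_space UNIV) (\<lambda>T. noff T i) = distr L (count_space UNIV) (\<lambda>T. noff T 1)) \<and>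
      (\<forall>i\<ge>1. integrable L (\<lambda>T. (real (noff T i))\<^sup>2))
      \<longrightarrow>
        conv_in_prob L nonbacktracking_bias \<Delta> \<and>
        weak_conv_m (\<lambda>k. distr L borel (nonbacktracking_bias k)) (distr L borel \<Delta>))
     \<and>
     (\<Lambda> \<in> measurable P (prob_algebra rgraph_space) \<and>
      (AE x in P. AE T in \<Lambda> x.
         (\<exists>v\<in>verts T. v \<noteq> vroot T) \<and> finite (verts T) \<and> \<not> bipartite T)
      \<longrightarrow>
        (AE x in P. AE T in \<Lambda> x. (\<lambda>k. backtracking_bias k T) \<longlonglongrightarrow> stationary_bias T) \<and>
        (\<forall>M. (AE x in P. \<Lambda> x = M) \<longrightarrow>
           weak_conv_m (\<lambda>k. distr M borel (backtracking_bias k)) (distr M borel stationary_bias)))"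
  (is "(?A \<longrightarrow> ?conv \<and> ?weak) \<and> (?B \<longrightarrow> ?as \<and> ?law)")
proof -
  interpret P: prob_space P by (rule P)
  have "?conv \<and> ?weak" if A: ?A
  proof -
    note A1 = A[THEN conjunct1] and A' = A[THEN conjunct2, THEN conjunct2]
    have L: "L \<in> space (prob_algebra rgraph_space)" using A' by (rule conjunct1)
    have Lp: "prob_space L" and sL: "sets L = sets rgraph_space"
      using L by (auto simp: space_prob_algebra)
    note lim = nonbacktracking_limit[OF P A1 L A'[THEN conjunct2, THEN conjunct1]
        A'[THEN conjunct2, THEN conjunct2, THEN conjunct1]
        A'[THEN conjunct2, THEN conjunct2, THEN conjunct2, THEN conjunct1]
        A'[THEN conjunct2, THEN conjunct2, THEN conjunct2, THEN conjunct2, THEN conjunct1]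
        A'[THEN conjunct2, THEN conjunct2, THEN conjunct2, THEN conjunct2, THEN conjunct2, THEN conjunct1]
        A'[THEN conjunct2, THEN conjunct2, THEN conjunct2, THEN conjunct2, THEN conjunct2, THEN conjunct2, THEN conjunct1]
        A'[THEN conjunct2, THEN conjunct2, THEN conjunct2, THEN conjunct2, THEN conjunct2, THEN conjunct2, THEN conjunct2]
        \<Delta>[unfolded m1 m2]]
    have "nonbacktracking_bias k \<in> borel_measurable L" for k
      using measurable_nonbacktracking_bias measurable_cong_sets[OF sL refl] by blast
    with lim show ?thesis by (intro conjI conv_in_prob_imp_weak_conv[OF Lp])
  qed
  moreover have "?as \<and> ?law" if B: ?B
  proof
    have \<Lambda>: "sets (\<Lambda> x) = sets rgraph_space" "prob_space (\<Lambda> x)" if "x \<in> space P" for x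
      using measurable_space[OF conjunct1[OF B] that] by (auto simp: space_prob_algebra)
    show as: ?as
      using conjunct2[OF B] AE_space
    proof eventually_elim
      case (elim x)
      have sp: "space (\<Lambda> x) = rgraphs" using sets_eq_imp_space_eq[OF \<Lambda>(1)[OF elim(2)]] by simp
      from elim(1) AE_space show ?case
      proof eventually_elim
        case (elim T)
        then show ?case by (intro backtracking_bias_tendsto) (auto simp: sp)
      qed
    qed
    show ?law
    proof (intro allI impI)
      fix M assume M: "AE x in P. \<Lambda> x = M"
      \<comment> \<open>Since \<open>P\<close> is a probability measure, some outcome has law \<open>M\<close> and satisfies the almost sure claim.\<close>
      have "\<exists>x\<in>space P. \<Lambda> x = M \<and> (AE T in \<Lambda> x. (\<lambda>k. backtracking_bias k T) \<longlonglongrightarrow> stationary_bias T)"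
      proof (rule ccontr)
        assume none: "\<not> ?thesis"
        have "AE x in P. False"
          using M as AE_space by eventually_elim (use none in blast)
        then show False using P.AE_False by blast
      qed
      then obtain x where x: "x \<in> space P" "\<Lambda> x = M"
        and lim: "AE T in M. (\<lambda>k. backtracking_bias k T) \<longlonglongrightarrow> stationary_bias T" by blast
      have Mp: "prob_space M" and sM: "sets M = sets rgraph_space" using \<Lambda>[OF x(1)] x(2) by auto
      have "backtracking_bias k \<in> borel_measurable M" "stationary_bias \<in> borel_measurable M" for k
        using measurable_backtracking_bias measurable_stationary_bias measurable_cong_sets[OF sM refl]
        by blast+
      then show "weak_conv_m (\<lambda>k. distr M borel (backtracking_bias k)) (distr M borel stationary_bias)"
        by (intro AE_tendsto_imp_weak_conv[OF Mp] lim)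
    qed
  qed
  ultimately show ?thesis by blast
qed

end
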